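(* Let $\varphi:\mathbb{R}^n\times\mathbb{R}^d\to(-\infty,\infty]$ be strongly amenable in $x$ at $\bar x$ with compatible parametrization in $w$ at $\bar w$, represented near $(\bar x,\bar w)$ as $\varphi=\theta\circ h$ as in the definition below. Let $\bar y\in\partial_x\varphi(\bar x,\bar w)$, $\bar z:=h(\bar x,\bar w)$, and $$M(\bar x,\bar w,\bar y):=\{v\in\mathbb{R}^m:\ v\in\partial\theta(\bar z),\ \nabla_x h(\bar x,\bar w)^*v=\bar y\}.$$ Assume the second-order qualification condition $$\partial^2\theta(\bar z,v)(0)\cap\ker\nabla_x h(\bar x,\bar w)^*=\{0\}\quad\text{for all } v\in M(\bar x,\bar w,\bar y).$$ Then for all $u\in\mathbb{R}^n$: $$\partial^2_x\varphi(\bar x,\bar w,\bar y)(u)\subset\bigcup_{v\in M(\bar x,\bar w,\bar y)}\Big[\nabla^2_{xx}\langle v,h\rangle(\bar x,\bar w)u+\nabla_x h(\bar x,\bar w)^*\partial^2\theta(\bar z,v)\big(\nabla_x h(\bar x,\bar w)u\big)\Big],$$ $$\tilde\partial^2_x\varphi(\bar x,\bar w,\bar y)(u)\subset\bigcup_{v\in M(\bar x,\bar w,\bar y)}\Big\{\Big(\nabla^2_{xx}\langle v,h\rangle(\bar x,\bar w)u+\nabla_x h(\bar x,\bar w)^*q,\ \nabla^2_{xw}\langle v,h\rangle(\bar x,\bar w)u+\nabla_w h(\bar x,\bar w)^*q\Big)\ \Big|\ q\in\partial^2\theta(\bar z,v)\big(\nabla_x h(\bar x,\bar w)u\big)\B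ig\}.$$
   Context: Notation (all in finite dimensions, $^*$ denotes matrix transpose). For $\psi:\mathbb{R}^k\to(-\infty,\infty]$ finite at $\bar x$: the regular subdifferential is $\hat\partial\psi(\bar x)=\{v:\liminf_{x\to\bar x}\frac{\psi(x)-\psi(\bar x)-\langle v,x-\bar x\rangle}{\|x-\bar x\|}\ge0\}$; the (limiting) subdifferential $\partial\psi(\bar x)$ is the set of $v$ for which there exist $x_k\to\bar x$ with $\psi(x_k)\to\psi(\bar x)$ and $v_k\in\hat\partial\psi(x_k)$ with $v_k\to v$; the singular subdifferential $\partial^\infty\psi(\bar x)$ is the set of limits of $\lambda_kv_k$ with $\lambda_k\downarrow0$, $v_k\in\hat\partial\psi(x_k)$, $x_k\to\bar x$, $\psi(x_k)\to\psi(\bar x)$. For a set $\Omega$ and $\bar x\in\Omega$, the regular normal cone is $\hat N(\bar x;\Omega)=\{v:\limsup_{x\to\bar x,\,x\in\Omega}\langle v,x-\bar x\rangle/\|x-\bar x\|\le0\}$ and the (limiting) normal cone $N(\bar x;\Omega)$ is the set of limits of $v_k\in\hat N(x_k;\Omega)$ with $x_k\to\bar x$, $x_k\in\Omega$. The coderivative of $F:\mathbb{R}^p\rightrightarrows\mathbb{R}^q$ at $(\bar x,\bar y)\in\operatorname{gph}F$ is $D^*F(\bar x,\bar y)(v)=\{u:(u,-v)\in N((\bar x,\bar y);\operatorname{gph}F)\}$. For $\bar y\in\partial\psi(\bar x)$, the second-order subdifferential is $\partial^2\psi(\bar x,\bar y)(u):=D^*(\partial\psi)(\bar x,\bar y)(u)$.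 For $\varphi:\mathbb{R}^n\times\mathbb{R}^d\to(-\infty,\infty]$: $\partial_x\varphi(x,w):=\partial\varphi(\cdot,w)(x)$, viewed as a map $\mathbb{R}^n\times\mathbb{R}^d\rightrightarrows\mathbb{R}^n$; $\partial^2_x\varphi(\bar x,\bar w,\bar y)(u):=\partial^2\varphi(\cdot,\bar w)(\bar x,\bar y)(u)$; $\tilde\partial^2_x\varphi(\bar x,\bar w,\bar y)(u):=D^*(\partial_x\varphi)((\bar x,\bar w),\bar y)(u)\subset\mathbb{R}^n\times\mathbb{R}^d$. Strong amenability: $\varphi$ is strongly amenable in $x$ at $\bar x$ with compatible parametrization in $w$ at $\bar w$ if there is a neighborhood $V$ of $(\bar x,\bar w)$ on which $\varphi=\theta\circ h$ with $h:\mathbb{R}^n\times\mathbb{R}^d\to\mathbb{R}^m$ of class $C^2$ and $\theta:\mathbb{R}^m\to(-\infty,\infty]$ proper, lower semicontinuous and convex, such that $\partial^\infty\theta(h(\bar x,\bar w))\cap\ker\nabla_x h(\bar x,\bar w)^*=\{0\}$. For $v\in\mathbb{R}^m$, $\langle v,h\rangle(x,w):=\langle v,h(x,w)\rangle$; $\nabla^2_{xx}\langle v,h\rangle(\bar x,\bar w)u\in\mathbb{R}^n$ has $i$-th entry $\sum_k\frac{\partial^2\langle v,h\rangle}{\partial x_i\partial x_k}(\bar x,\bar w)u_k$ and $\nabla^2_{xw}\langle v,h\rangle(\bar x,\bar w)u\in\mathbb{R}^d$ has $j$-th entry $\sum_k\frac{\partial^2\langle v,h\rangle}{\partial w_j\partial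 x_k}(\bar x,\bar w)u_k$. *)

theory Defs
  imports "HOL-Analysis.Analysis"
begin

definition proper_fun :: "('a \<Rightarrow> ereal) \<Rightarrow> bool" where
  "proper_fun f \<longleftrightarrow> (\<forall>x. f x \<noteq> -\<infinity>) \<and> (\<exists>x. f x \<noteq> \<infinity>)"

definition lsc_fun :: "('a::topological_space \<Rightarrow> ereal) \<Rightarrow> bool" where
  "lsc_fun f \<longleftrightarrow> (\<forall>x. f x \<le> Liminf (at x) f)"

definition convex_fun :: "('a::real_vector \<Rightarrow> ereal) \<Rightarrow> bool" where
  "convex_fun f \<longleftrightarrow> convex {(x, t::real). f x \<le> ereal t}"

definition reg_subdiff :: "('a::euclidean_space \<Rightarrow> ereal) \<Rightarrow> 'a \<Rightarrow> 'a set" where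
  "reg_subdiff \<psi> x = {v. \<bar>\<psi> x\<bar> \<noteq> \<infinity> \<and>
     Liminf (at x) (\<lambda>y. (\<psi> y - \<psi> x - ereal (v \<bullet> (y - x))) / ereal (norm (y - x))) \<ge> 0}"

definition subdiff :: "('a::euclidean_space \<Rightarrow> ereal) \<Rightarrow> 'a \<Rightarrow> 'a set" where
  "subdiff \<psi> x = {v. \<bar>\<psi> x\<bar> \<noteq> \<infinity> \<and>
     (\<exists>xs vs. xs \<longlonglongrightarrow> x \<and> (\<lambda>k. \<psi> (xs k)) \<longlonglongrightarrow> \<psi> x \<and>
        (\<forall>k. vs k \<in> reg_subdiff \<psi> (xs k)) \<and> vs \<longlonglongrightarrow> v)}"

definition sing_subdiff :: "('a::euclidean_space \<Rightarrow> ereal) \<Rightarrow> 'a \<Rightarrow> 'a set" where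
  "sing_subdiff \<psi> x = {v. \<bar>\<psi> x\<bar> \<noteq> \<infinity> \<and>
     (\<exists>lam xs vs. (\<forall>k. lam k > (0::real)) \<and> lam \<longlonglongrightarrow> 0 \<and>
        xs \<longlonglongrightarrow> x \<and> (\<lambda>k. \<psi> (xs k)) \<longlonglongrightarrow> \<psi> x \<and>
        (\<forall>k. vs k \<in> reg_subdiff \<psi> (xs k)) \<and> (\<lambda>k. lam k *\<^sub>R vs k) \<longlonglongrightarrow> v)}"

definition reg_normal_cone :: "'a::euclidean_space \<Rightarrow> 'a set \<Rightarrow> 'a set" where
  "reg_normal_cone x \<Omega> = {v. x \<in> \<Omega> \<and>
     Limsup (at x within \<Omega>) (\<lambda>y. ereal ((v \<bullet> (y - x)) / norm (y - x))) \<le> 0}"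

definition normal_cone :: "'a::euclidean_space \<Rightarrow> 'a set \<Rightarrow> 'a set" where
  "normal_cone x \<Omega> = {v. x \<in> \<Omega> \<and>
     (\<exists>xs vs. (\<forall>k. xs k \<in> \<Omega>) \<and> xs \<longlonglongrightarrow> x \<and>
        (\<forall>k. vs k \<in> reg_normal_cone (xs k) \<Omega>) \<and> vs \<longlonglongrightarrow> v)}"

definition graph :: "('a \<Rightarrow> 'b set) \<Rightarrow> ('a \<times> 'b) set" where
  "graph F = {(x, y). y \<in> F x}"

definition coderiv ::
  "('a::euclidean_space \<Rightarrow> 'b::euclidean_space set) \<Rightarrow> 'a \<Rightarrow> 'b \<Rightarrow> 'b \<Rightarrow> 'a set" where
  "coderiv F x y v = {u. (u, - v) \<in> normal_cone (x, y) (graph F)}"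

definition second_subdiff ::
  "('a::euclidean_space \<Rightarrow> ereal) \<Rightarrow> 'a \<Rightarrow> 'a \<Rightarrow> 'a \<Rightarrow> 'a set" where
  "second_subdiff \<psi> x y u = coderiv (subdiff \<psi>) x y u"

definition partial_subdiff_x ::
  "(('a::euclidean_space \<times> 'b) \<Rightarrow> ereal) \<Rightarrow> ('a \<times> 'b) \<Rightarrow> 'a set" where
  "partial_subdiff_x \<phi> p = subdiff (\<lambda>x. \<phi> (x, snd p)) (fst p)"

definition second_subdiff_x ::
  "(('a::euclidean_space \<times> 'b) \<Rightarrow> ereal) \<Rightarrow> 'a \<Rightarrow> 'b \<Rightarrow> 'a \<Rightarrow> 'a \<Rightarrow> 'a set" where
  "second_subdiff_x \<phi> x w y u = second_subdiff (\<lambda>x'. \<phi> (x', w)) x y u"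

definition second_subdiff_x_tilde ::
  "(('a::euclidean_space \<times> 'b::euclidean_space) \<Rightarrow> ereal) \<Rightarrow> 'a \<Rightarrow> 'b \<Rightarrow> 'a \<Rightarrow> 'a
     \<Rightarrow> ('a \<times> 'b) set" where
  "second_subdiff_x_tilde \<phi> x w y u = coderiv (partial_subdiff_x \<phi>) (x, w) y u"

definition C2_with ::
  "('a::euclidean_space \<Rightarrow> 'c::euclidean_space) \<Rightarrow> ('a \<Rightarrow> ('a \<Rightarrow>\<^sub>L 'c))
     \<Rightarrow> ('a \<Rightarrow> ('a \<Rightarrow>\<^sub>L ('a \<Rightarrow>\<^sub>L 'c))) \<Rightarrow> bool" where
  "C2_with h Dh D2h \<longleftrightarrow>
     (\<forall>p. (h has_derivative blinfun_apply (Dh p)) (at p)) \<and>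
     (\<forall>p. (Dh has_derivative blinfun_apply (D2h p)) (at p)) \<and>
     continuous_on UNIV D2h"

definition jac_x :: "(('a::real_normed_vector \<times> 'b::real_normed_vector) \<Rightarrow>\<^sub>L 'c::real_normed_vector) \<Rightarrow> 'a \<Rightarrow> 'c" where
  "jac_x L u = blinfun_apply L (u, 0)"

definition jac_w :: "(('a::real_normed_vector \<times> 'b::real_normed_vector) \<Rightarrow>\<^sub>L 'c::real_normed_vector) \<Rightarrow> 'b \<Rightarrow> 'c" where
  "jac_w L z = blinfun_apply L (0, z)"

text \<open>nabla^2_xx <v,h> u (i-th entry: sum_k d^2<v,h>/dx_i dx_k u_k) and
  nabla^2_xw <v,h> u (j-th entry: sum_k d^2<v,h>/dw_j dx_k u_k), computed from the
  second derivative B = D^2 h(p), where B a b is the derivative of (Dh . b) in direction a.\<close>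
definition hess_xx ::
  "(((real^'n) \<times> (real^'d)) \<Rightarrow>\<^sub>L (((real^'n) \<times> (real^'d)) \<Rightarrow>\<^sub>L (real^'m))) \<Rightarrow> real^'m \<Rightarrow> real^'n \<Rightarrow> real^'n" where
  "hess_xx B v u = (\<chi> i. v \<bullet> blinfun_apply (blinfun_apply B (axis i 1, 0)) (u, 0))"

definition hess_xw ::
  "(((real^'n) \<times> (real^'d)) \<Rightarrow>\<^sub>L (((real^'n) \<times> (real^'d)) \<Rightarrow>\<^sub>L (real^'m))) \<Rightarrow> real^'m \<Rightarrow> real^'n \<Rightarrow> real^'d" where
  "hess_xw B v u = (\<chi> j. v \<bullet> blinfun_apply (blinfun_apply B (0, axis j 1)) (u, 0))"

end

theory Submission
  imports Defs
begin

text \<open>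
  Convexity of \<open>\<theta>\<close> identifies \<open>\<partial>\<^sup>\<infinity>\<theta>\<close> with the normals to the domain of \<open>\<theta>\<close>, so the first-order qualification
  condition persists at nearby points and keeps multipliers bounded. Hence near the base point the
  graph of \<open>\<partial>\<^sub>x\<phi>\<close> is the image under \<open>T (p, v) = (p, \<nabla>\<^sub>xh(p)\<^sup>* v)\<close> of the set \<open>Q\<close> of pairs with
  \<open>v \<in> \<partial>\<theta>(h p)\<close>. Regular normals to the graph of \<open>\<partial>\<^sub>x\<phi>\<close> pull back along \<open>T\<close> to regular normals to \<open>Q\<close>; the
  derivative of \<open>\<nabla>\<^sub>xh\<close> contributes the Hessian terms. Finally \<open>Q\<close> is the preimage of the closed graph of \<open>\<partial>\<theta>\<close>
  under \<open>(p, v) \<mapsto> (h p, v)\<close>, and the second-order qualification condition is exactly what the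
  preimage rule for limiting normals requires. Both the first-order chain rule and the preimage
  rule come from one fuzzy chain rule for lower semicontinuous functions, obtained by penalization.
  The two inclusions are instances of the same statement, with parameter space \<open>x\<close> (\<open>w\<close> fixed) or \<open>(x, w)\<close>.
\<close>

subsection \<open>Regular subgradients and normals\<close>

text \<open>Away from \<open>x\<close> the quotient is cleared by \<open>norm (y - x) > 0\<close>;
  infinite values of \<open>\<psi> y\<close> are compared separately. The error stands on the right
  so that no \<open>ereal\<close> difference remains.\<close>

lemma reg_subdiff_iff:
  "v \<in> reg_subdiff \<psi> x \<longleftrightarrow> \<bar>\<psi> x\<bar> \<noteq> \<infinity> \<and>
    (\<forall>e>0. \<forall>\<^sub>F y in at x. \<psi> x + ereal (v \<bullet> (y - x)) \<le> \<psi> y + ereal (e * norm (y - x)))"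
proof (cases "\<bar>\<psi> x\<bar> = \<infinity>")
  case False
  then obtain c where c: "\<psi> x = ereal c" by auto
  let ?q = "\<lambda>y. (\<psi> y - \<psi> x - ereal (v \<bullet> (y - x))) / ereal (norm (y - x))"
  have q: "?q y = (case \<psi> y of ereal t \<Rightarrow> ereal ((t - c - v \<bullet> (y - x)) / norm (y - x)) | PInfty \<Rightarrow> \<infinity> | MInfty \<Rightarrow> -\<infinity>)"
    if "y \<noteq> x" for y
    using that c by (cases "\<psi> y") (auto simp: ereal_divide)
  have "0 \<le> Liminf (at x) ?q \<longleftrightarrow> (\<forall>e>0. \<forall>\<^sub>F y in at x. \<psi> x + ereal (v \<bullet> (y - x)) \<le> \<psi> y + ereal (e * norm (y - x)))"
    (is "_ \<longleftrightarrow> ?R")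
  proof
    assume L: "0 \<le> Liminf (at x) ?q"
    show ?R
    proof (intro allI impI)
      fix e :: real assume "e > 0"
      then have "\<forall>\<^sub>F y in at x. ereal (- e) < ?q y"
        using L unfolding le_Liminf_iff by simp
      moreover have "\<forall>\<^sub>F y in at x. y \<noteq> x"
        by (simp add: eventually_at_filter)
      ultimately show "\<forall>\<^sub>F y in at x. \<psi> x + ereal (v \<bullet> (y - x)) \<le> \<psi> y + ereal (e * norm (y - x))"
      proof eventually_elim
        case (elim y)
        have "norm (y - x) > 0" using elim by simp
        then show ?case using elim(1) unfolding q[OF elim(2)]
          by (cases "\<psi> y") (auto simp: c field_simps)
      qed
    qed
  next
    assume R: ?R
    show "0 \<le> Liminf (at x) ?q" unfolding le_Liminf_iff
    proof (intro allI impI)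
      fix b :: ereal assume b: "b < 0"
      obtain e where e: "e > 0" "b < ereal (- e)"
      proof -
        from ereal_dense2[OF b] obtain z where z: "b < ereal z" "ereal z < 0" by auto
        show ?thesis by (rule that[of "- z"]) (use z in auto)
      qed
      have "\<forall>\<^sub>F y in at x. y \<noteq> x"
        by (simp add: eventually_at_filter)
      with R[rule_format, OF e(1)] show "\<forall>\<^sub>F y in at x. b < ?q y"
      proof eventually_elim
        case (elim y)
        have n: "norm (y - x) > 0" using elim by simp
        show ?case
        proof (cases "\<psi> y")
          case (real t)
          have "c + v \<bullet> (y - x) \<le> t + e * norm (y - x)" using elim(1) real c by simp
          then have "- e \<le> (t - c - v \<bullet> (y - x)) / norm (y - x)"
            using n by (simp add: field_simps)
          then show ?thesis unfolding q[OF elim(2)] using real e(2) by (simp add: less_le_trans)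
        qed (use elim q[OF elim(2)] c b in auto)
      qed
    qed
  qed
  then show ?thesis unfolding reg_subdiff_def using False by simp
qed (simp add: reg_subdiff_def)

lemma reg_normal_cone_iff:
  "v \<in> reg_normal_cone x \<Omega> \<longleftrightarrow> x \<in> \<Omega> \<and>
    (\<forall>e>0. \<forall>\<^sub>F y in at x within \<Omega>. v \<bullet> (y - x) \<le> e * norm (y - x))"
proof -
  let ?q = "\<lambda>y. ereal ((v \<bullet> (y - x)) / norm (y - x))"
  have "Limsup (at x within \<Omega>) ?q \<le> 0 \<longleftrightarrow> (\<forall>e>0. \<forall>\<^sub>F y in at x within \<Omega>. v \<bullet> (y - x) \<le> e * norm (y - x))"
    (is "_ \<longleftrightarrow> ?R")
  proof
    assume L: "Limsup (at x within \<Omega>) ?q \<le> 0"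
    show ?R
    proof (intro allI impI)
      fix e :: real assume "e > 0"
      then have "\<forall>\<^sub>F y in at x within \<Omega>. ?q y < ereal e"
        using L[unfolded Limsup_le_iff, rule_format, of "ereal e"] by simp
      moreover have "\<forall>\<^sub>F y in at x within \<Omega>. y \<noteq> x"
        by (simp add: eventually_at_filter)
      ultimately show "\<forall>\<^sub>F y in at x within \<Omega>. v \<bullet> (y - x) \<le> e * norm (y - x)"
        by eventually_elim (auto simp: field_simps)
    qed
  next
    assume R: ?R
    show "Limsup (at x within \<Omega>) ?q \<le> 0" unfolding Limsup_le_iff
    proof (intro allI impI)
      fix b :: ereal assume b: "b > 0"
      then obtain e where e: "e > 0" "ereal e < b"
        using ereal_dense2 by (metis ereal_less(2))
      have "\<forall>\<^sub>F y in at x within \<Omega>. y \<noteq> x"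
        by (simp add: eventually_at_filter)
      with R[rule_format, OF e(1)] show "\<forall>\<^sub>F y in at x within \<Omega>. ?q y < b"
      proof eventually_elim
        case (elim y)
        then have "?q y \<le> ereal e" by (simp add: field_simps)
        then show ?case using e(2) by (rule le_less_trans)
      qed
    qed
  qed
  then show ?thesis unfolding reg_normal_cone_def by simp
qed

section \<open>Lower semicontinuity and minima\<close>

lemma lsc_fun_eventually:
  assumes "lsc_fun f" "c < f x"
  shows "\<forall>\<^sub>F y in nhds x. c < f y"
proof -
  have "\<forall>\<^sub>F y in at x. c < f y"
    using assms unfolding lsc_fun_def le_Liminf_iff by blast
  then show ?thesis using assms(2) by (simp add: eventually_nhds_conv_at)
qed

text \<open>If every \<open>x\<close> in \<open>K\<close> were beaten by some \<open>q x\<close>,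
  the neighborhoods on which \<open>f\<close> exceeds \<open>f (q x)\<close> would cover
  \<open>K\<close>. In a finite subcover, the point \<open>q c\<close> of least value lies in some
  \<open>U d\<close>, so \<open>f (q d)\<close> is smaller still.\<close>

lemma lsc_attains_inf_compact:
  fixes f :: "'a::topological_space \<Rightarrow> ereal"
  assumes "compact K" "K \<noteq> {}"
    and lsc: "\<And>x c. x \<in> K \<Longrightarrow> c < f x \<Longrightarrow> \<forall>\<^sub>F y in nhds x. c < f y"
  obtains x where "x \<in> K" "\<And>y. y \<in> K \<Longrightarrow> f x \<le> f y"
proof (rule ccontr)
  assume "\<not> thesis"
  then have "\<forall>x\<in>K. \<exists>y\<in>K. f y < f x"
    using that by (meson not_le_imp_less)
  then obtain q where q: "\<And>x. x \<in> K \<Longrightarrow> q x \<in> K \<and> f (q x) < f x" by metis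
  have "\<forall>x\<in>K. \<exists>U. open U \<and> x \<in> U \<and> (\<forall>y\<in>U. f (q x) < f y)"
    using lsc q unfolding eventually_nhds by blast
  then obtain U where U: "\<And>x. x \<in> K \<Longrightarrow> open (U x) \<and> x \<in> U x \<and> (\<forall>y\<in>U x. f (q x) < f y)" by metis
  obtain C where C: "C \<subseteq> K" "finite C" "K \<subseteq> (\<Union>c\<in>C. U c)"
    using compactE_image[OF assms(1), of K U] U by (metis UN_I subsetI)
  have "C \<noteq> {}" using C(3) assms(2) by auto
  let ?m = "Min ((\<lambda>c. f (q c)) ` C)"
  have "?m \<in> (\<lambda>c. f (q c)) ` C" using C(2) \<open>C \<noteq> {}\<close> by (intro Min_in) auto
  then obtain c where c: "c \<in> C" "f (q c) = ?m" by auto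
  then have "q c \<in> K" using q C(1) by auto
  then obtain d where d: "d \<in> C" "q c \<in> U d" using C(3) by auto
  then have "f (q d) < f (q c)" using U C(1) by auto
  moreover have "?m \<le> f (q d)" using d(1) C(2) by auto
  ultimately show False using c(2) by auto
qed

lemma lsc_le_of_tendsto:
  fixes \<theta> :: "'a::topological_space \<Rightarrow> ereal"
  assumes "lsc_fun \<theta>" "zs \<longlonglongrightarrow> z" "\<And>k. \<theta> (zs k) \<le> b k" "b \<longlonglongrightarrow> c"
  shows "\<theta> z \<le> c"
proof (rule ccontr)
  assume "\<not> \<theta> z \<le> c"
  then obtain d where d: "c < d" "d < \<theta> z" using dense not_le by metis
  have "\<forall>\<^sub>F k in sequentially. d < \<theta> (zs k)"
    using lsc_fun_eventually[OF assms(1) d(2)] assms(2) filterlim_iff by blast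
  moreover have "\<forall>\<^sub>F k in sequentially. b k < d"
    using assms(4) d(1) by (rule order_tendstoD)
  ultimately have "\<forall>\<^sub>F k in sequentially. False"
    by eventually_elim (use assms(3) in \<open>meson less_asym' order.strict_trans2\<close>)
  then show False by simp
qed

text \<open>The difference quotients along \<open>d\<close> from the right are at least
  \<open>- (e * norm d)\<close>, and this survives the limit.\<close>

lemma derivative_bound_of_local_min:
  fixes f :: "'a::real_normed_vector \<Rightarrow> real"
  assumes der: "(f has_derivative f') (at x)"
    and min: "\<forall>\<^sub>F y in at x. f x \<le> f y + e * norm (y - x)"
  shows "- (e * norm d) \<le> f' d"
proof (cases "d = 0")
  case True
  then show ?thesis using der by (simp add: has_derivative_bounded_linear linear_simps)
next
  case False
  have lin: "bounded_linear f'" using der by (rule has_derivative_bounded_linear)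
  let ?g = "\<lambda>t::real. x + t *\<^sub>R d"
  have "((\<lambda>t. f (?g t)) has_derivative (\<lambda>t. f' (t *\<^sub>R d))) (at 0)"
    by (rule has_derivative_compose[of ?g "\<lambda>t. t *\<^sub>R d" 0 UNIV f f'])
       (use der in \<open>auto intro!: derivative_eq_intros\<close>)
  then have "((\<lambda>t. f (?g t)) has_real_derivative f' d) (at 0)"
    unfolding has_field_derivative_def
    by (rule has_derivative_eq_rhs) (auto simp: fun_eq_iff lin[THEN bounded_linear.linear, THEN linear_cmul] )
  then have lim: "((\<lambda>t. (f (?g t) - f x) / t) \<longlongrightarrow> f' d) (at 0 within {0<..})"
    unfolding has_field_derivative_iff by (auto intro: tendsto_within_subset)
  have "filterlim ?g (at x) (at 0 within {0<..})"
    unfolding filterlim_at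
    using False by (auto intro!: tendsto_eq_intros simp: eventually_at_filter)
  then have "\<forall>\<^sub>F t in at 0 within {0<..}. f x \<le> f (?g t) + e * norm (?g t - x)"
    using min unfolding filterlim_iff by blast
  moreover have "\<forall>\<^sub>F t in at (0::real) within {0<..}. t > 0"
    by (simp add: eventually_at_filter)
  ultimately have "\<forall>\<^sub>F t in at 0 within {0<..}. - (e * norm d) \<le> (f (?g t) - f x) / t"
    by eventually_elim (auto simp: field_simps)
  then show ?thesis
    using tendsto_lowerbound[OF lim] by (simp add: trivial_limit_at_right_real)
qed

subsection \<open>Fuzzy chain rule and limits of multipliers\<close>

lemma lsc_add_continuous:
  fixes \<theta> :: "'a::t2_space \<Rightarrow> ereal" and g :: "'a \<Rightarrow> real"
  assumes lsc: "\<And>c. c < \<theta> x \<Longrightarrow> \<forall>\<^sub>F y in nhds x. c < \<theta> y"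
    and nm: "\<And>y. \<theta> y \<noteq> -\<infinity>"
    and cont: "isCont g x"
    and c: "c < \<theta> x + ereal (g x)"
  shows "\<forall>\<^sub>F y in nhds x. c < \<theta> y + ereal (g y)"
proof (cases c)
  case (real b)
  have "ereal (b - g x) < \<theta> x" using c real by (cases "\<theta> x") auto
  \<comment> \<open>\<open>d\<close> splits the gap: near \<open>x\<close>, \<open>\<theta>\<close>
    stays above \<open>d\<close> and \<open>g\<close> above \<open>b - d\<close>.\<close>
  then obtain d where d: "ereal (b - g x) < ereal d" "ereal d < \<theta> x" using ereal_dense2 by blast
  have "(g \<longlongrightarrow> g x) (nhds x)" using cont by (simp add: isCont_def tendsto_at_iff_tendsto_nhds)
  moreover have "b - d < g x" using d(1) by simp
  ultimately have "\<forall>\<^sub>F y in nhds x. b - d < g y" by (rule order_tendstoD)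
  with lsc[OF d(2)] show ?thesis
  proof eventually_elim
    case (elim y)
    then show ?case using real by (cases "\<theta> y") auto
  qed
next
  case PInf
  then show ?thesis using c by simp
next
  case MInf
  have "-\<infinity> < \<theta> y + ereal (g y)" for y using nm[of y] by (cases "\<theta> y") auto
  then show ?thesis using MInf by simp
qed

text \<open>Penalization: minimize \<open>\<theta> z + n/2 \<bar>z - F x\<bar>\<^sup>2 - y \<bullet> x + e \<bar>x - x0\<bar>\<close> near \<open>(x0, F x0)\<close>. The regular
  subgradient inequality holds with \<open>e/2\<close>, so \<open>x0\<close> is a strict minimizer of the unpenalized problem,
  which forces the penalized minimizers to approach \<open>(x0, F x0)\<close>.\<close>

lemma fuzzy_chain_rule:
  fixes \<theta> :: "'b::euclidean_space \<Rightarrow> ereal" and F :: "'a::euclidean_space \<Rightarrow> 'b"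
  assumes lsc: "lsc_fun \<theta>" and nm: "\<And>z. \<theta> z \<noteq> -\<infinity>"
    and F: "\<And>x. (F has_derivative F' x) (at x)"
    and y: "y \<in> reg_subdiff (\<lambda>x. \<theta> (F x)) x0"
    and e: "e > 0"
  obtains x z v where "dist x x0 < e" "dist z (F x0) < e" "v \<in> reg_subdiff \<theta> z"
    "\<And>d. \<bar>v \<bullet> F' x d - y \<bullet> d\<bar> \<le> e * norm d"
proof -
  have "\<bar>\<theta> (F x0)\<bar> \<noteq> \<infinity>" using y by (simp add: reg_subdiff_def)
  then obtain c0 where c0: "\<theta> (F x0) = ereal c0" by auto
  have "\<forall>\<^sub>F x in at x0. \<theta> (F x0) + ereal (y \<bullet> (x - x0)) \<le> \<theta> (F x) + ereal (e / 2 * norm (x - x0))"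
    using y e unfolding reg_subdiff_iff by (simp only: half_gt_zero)
  then obtain r' where r': "r' > 0"
    "\<And>x. x \<noteq> x0 \<Longrightarrow> dist x x0 < r' \<Longrightarrow> ereal c0 + ereal (y \<bullet> (x - x0)) \<le> \<theta> (F x) + ereal (e / 2 * norm (x - x0))"
    unfolding eventually_at c0 by auto
  \<comment> \<open>Halving makes the closed ball of radius \<open>r\<close> fit into the open ball
    on which the subgradient inequality holds.\<close>
  define r where "r = r' / 2"
  have r: "r > 0" using r' by (simp add: r_def)
  have reg: "ereal (c0 + y \<bullet> (x - x0)) \<le> \<theta> (F x) + ereal (e / 2 * norm (x - x0))" if "dist x x0 \<le> r" for x
    using r'(2)[of x] that r'(1) c0 by (cases "x = x0") (auto simp: r_def)
  define K where "K = cball x0 r \<times> cball (F x0) r"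
  have K: "compact K" "(x0, F x0) \<in> K" using r by (auto simp: K_def intro: compact_Times)
  define g where "g n p = real n / 2 * ((snd p - F (fst p)) \<bullet> (snd p - F (fst p))) - y \<bullet> (fst p - x0) + e * norm (fst p - x0)"
    for n and p :: "'a \<times> 'b"
  have contF: "isCont F x" for x using F has_derivative_continuous by (metis)
  have contg: "isCont (g n) p" for n p
    unfolding g_def by (intro continuous_intros isCont_o2[OF _ contF])
  have "\<exists>p. p \<in> K \<and> (\<forall>q\<in>K. \<theta> (snd p) + ereal (g n p) \<le> \<theta> (snd q) + ereal (g n q))" for n
  proof (rule lsc_attains_inf_compact[OF K(1), of "\<lambda>p. \<theta> (snd p) + ereal (g n p)"])
    show "K \<noteq> {}" using K by auto
    fix p c assume c: "c < \<theta> (snd p) + ereal (g n p)"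
    show "\<forall>\<^sub>F y in nhds p. c < \<theta> (snd y) + ereal (g n y)"
    proof (rule lsc_add_continuous[where \<theta> = "\<lambda>p. \<theta> (snd p)" and g = "g n", OF _ nm contg c])
      fix c assume "c < \<theta> (snd p)"
      then have "\<forall>\<^sub>F z in nhds (snd p). c < \<theta> z" by (rule lsc_fun_eventually[OF lsc])
      moreover have "filterlim snd (nhds (snd p)) (nhds p)"
        using tendsto_snd filterlim_ident by blast
      ultimately show "\<forall>\<^sub>F y in nhds p. c < \<theta> (snd y)" unfolding filterlim_iff by blast
    qed
  qed blast
  then obtain P where P: "\<And>n. P n \<in> K"
    "\<And>n q. q \<in> K \<Longrightarrow> \<theta> (snd (P n)) + ereal (g n (P n)) \<le> \<theta> (snd q) + ereal (g n q)"
    by metis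
  define t where "t n = real_of_ereal (\<theta> (snd (P n)))" for n
  have le0: "\<theta> (snd (P n)) + ereal (g n (P n)) \<le> ereal c0" for n
    using P(2)[OF K(2), of n] by (simp add: g_def c0)
  have t: "\<theta> (snd (P n)) = ereal (t n)" for n
    using le0[of n] nm[of "snd (P n)"] by (cases "\<theta> (snd (P n))") (auto simp: t_def)
  have le: "t n + g n (P n) \<le> c0" for n using le0[of n] by (simp add: t)
  \<comment> \<open>The minimum \<open>m\<close> of \<open>\<theta>\<close> over the ball bounds
    every \<open>t n\<close> from below, so the penalty terms stay bounded.\<close>
  obtain zm where zm: "zm \<in> cball (F x0) r" "\<And>z. z \<in> cball (F x0) r \<Longrightarrow> \<theta> zm \<le> \<theta> z"
    by (rule lsc_attains_inf_compact[of "cball (F x0) r" \<theta>])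
       (use r lsc_fun_eventually[OF lsc] in auto)
  have "\<theta> zm \<le> ereal c0" using zm(2)[of "F x0"] r by (simp add: c0)
  then obtain m where m: "\<theta> zm = ereal m" using nm[of zm] by (cases "\<theta> zm") auto
  have mt: "m \<le> t n" for n
    using zm(2)[of "snd (P n)"] P(1)[of n] by (simp add: m t K_def mem_Times_iff)
  obtain l \<rho> where \<rho>: "l \<in> K" "strict_mono \<rho>" "(P \<circ> \<rho>) \<longlonglongrightarrow> l"
    using K(1) P(1) unfolding compact_def by metis
  obtain xh zh where l: "l = (xh, zh)" by (cases l)
  define X where "X n = fst (P (\<rho> n))" for n
  define Z where "Z n = snd (P (\<rho> n))" for n
  have X: "X \<longlonglongrightarrow> xh" and Z: "Z \<longlonglongrightarrow> zh"
    using tendsto_fst[OF \<rho>(3)] tendsto_snd[OF \<rho>(3)] by (simp_all add: l X_def[abs_def] Z_def[abs_def] o_def)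
  have XK: "dist (X n) x0 \<le> r" "dist (Z n) (F x0) \<le> r" for n
    using P(1)[of "\<rho> n"] by (auto simp: K_def X_def Z_def mem_Times_iff dist_commute)
  have FX: "(\<lambda>n. F (X n)) \<longlonglongrightarrow> F xh" by (rule isCont_tendsto_compose[OF contF X])
  have yb: "y \<bullet> (X n - x0) \<le> norm y * r" for n
    using norm_cauchy_schwarz[of y "X n - x0"] XK(1)[of n]
    by (smt (verit) dist_norm mult_left_mono norm_ge_zero)
  define B where "B = 2 * (c0 - m + norm y * r)"
  have le': "t (\<rho> n) + real (\<rho> n) / 2 * ((Z n - F (X n)) \<bullet> (Z n - F (X n))) - y \<bullet> (X n - x0) + e * norm (X n - x0) \<le> c0" for n
    using le[of "\<rho> n"] by (simp add: g_def X_def Z_def)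
  have "real (\<rho> n) * ((Z n - F (X n)) \<bullet> (Z n - F (X n))) \<le> B" for n
  proof -
    have "0 \<le> e * norm (X n - x0)" using e by simp
    then show ?thesis using le'[of n] yb[of n] mt[of "\<rho> n"] unfolding B_def by argo
  qed
  \<comment> \<open>Strict monotonicity gives \<open>\<rho> n \<ge> n\<close>, so
    \<open>n > 0\<close> makes the penalty weight nonzero; the distance from \<open>Z n\<close> to
    \<open>F (X n)\<close> then vanishes in the limit.\<close>
  then have bd: "(Z n - F (X n)) \<bullet> (Z n - F (X n)) \<le> B * inverse (real (\<rho> n))" if "n > 0" for n
    using that seq_suble[OF \<rho>(2), of n] by (simp add: field_simps)
  have "filterlim (\<lambda>n. real (\<rho> n)) at_top sequentially"
    by (rule filterlim_compose[OF filterlim_real_sequentially filterlim_subseq[OF \<rho>(2)]])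
  then have "(\<lambda>n. inverse (real (\<rho> n))) \<longlonglongrightarrow> 0"
    by (rule tendsto_inverse_0_at_top)
  then have Blim: "(\<lambda>n. B * inverse (real (\<rho> n))) \<longlonglongrightarrow> B * 0" by (intro tendsto_intros)
  have "(\<lambda>n. (Z n - F (X n)) \<bullet> (Z n - F (X n))) \<longlonglongrightarrow> (zh - F xh) \<bullet> (zh - F xh)"
    by (intro tendsto_intros Z FX)
  then have "(zh - F xh) \<bullet> (zh - F xh) \<le> B * 0"
    by (rule LIMSEQ_le[OF _ Blim]) (use bd in \<open>auto intro!: exI[of _ 1]\<close>)
  then have zh: "zh = F xh" using inner_eq_zero_iff[of "zh - F xh"] inner_ge_zero[of "zh - F xh"] by auto
  \<comment> \<open>Dropping the nonnegative penalty and passing to the limit keeps the full slope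
    \<open>e\<close>, while \<open>reg\<close> gives the reverse bound with slope
    \<open>e / 2\<close>; together they force \<open>xh = x0\<close>.\<close>
  have "\<theta> zh \<le> ereal (c0 + y \<bullet> (xh - x0) - e * norm (xh - x0))"
  proof (rule lsc_le_of_tendsto[OF lsc Z])
    show "\<theta> (Z k) \<le> ereal (c0 + y \<bullet> (X k - x0) - e * norm (X k - x0))" for k
    proof -
      have "0 \<le> real (\<rho> k) / 2 * ((Z k - F (X k)) \<bullet> (Z k - F (X k)))" by simp
      then have "t (\<rho> k) \<le> c0 + y \<bullet> (X k - x0) - e * norm (X k - x0)" using le'[of k] by linarith
      then show ?thesis using t[of "\<rho> k"] by (simp add: Z_def)
    qed
    show "(\<lambda>k. ereal (c0 + y \<bullet> (X k - x0) - e * norm (X k - x0))) \<longlonglongrightarrow> ereal (c0 + y \<bullet> (xh - x0) - e * norm (xh - x0))"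
      by (intro tendsto_intros X)
  qed
  moreover have "dist xh x0 \<le> r" using \<rho>(1) by (simp add: l K_def dist_commute)
  ultimately have "e / 2 * norm (xh - x0) \<le> 0" using reg[of xh] nm[of "F xh"]
    unfolding zh by (cases "\<theta> (F xh)") auto
  then have xh: "xh = x0" using e by (simp add: mult_le_0_iff)
  have "\<forall>\<^sub>F n in sequentially. dist (X n) x0 < min r e" "\<forall>\<^sub>F n in sequentially. dist (Z n) (F x0) < min r e"
    by (rule tendstoD[OF X[unfolded xh]] tendstoD[OF Z[unfolded zh xh]], use r e in simp)+
  then have "\<forall>\<^sub>F n in sequentially. dist (X n) x0 < min r e \<and> dist (Z n) (F x0) < min r e"
    by (rule eventually_conj)
  then obtain N where N: "dist (X N) x0 < min r e" "dist (Z N) (F x0) < min r e"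
    by (auto simp: eventually_sequentially)
  define n where "n = real (\<rho> N)"
  have n0: "n \<ge> 0" by (simp add: n_def)
  \<comment> \<open>Minus the gradient in \<open>z\<close> of the penalty at the minimizer.\<close>
  define v where "v = n *\<^sub>R (F (X N) - Z N)"
  let ?s = "\<lambda>a::'b. a \<bullet> a"
  have minim: "ereal (t (\<rho> N) + (n / 2 * ?s (Z N - F (X N)) - y \<bullet> (X N - x0) + e * norm (X N - x0)))
      \<le> \<theta> z + ereal (n / 2 * ?s (z - F x) - y \<bullet> (x - x0) + e * norm (x - x0))"
    if "dist x x0 \<le> r" "dist z (F x0) \<le> r" for x z
    using P(2)[of "(x, z)" "\<rho> N"] that
    by (simp add: K_def dist_commute t g_def n_def X_def Z_def)
  have tN: "\<theta> (Z N) = ereal (t (\<rho> N))" by (simp add: Z_def t)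
  show ?thesis
  proof (rule that[of "X N" "Z N" v])
    show "dist (X N) x0 < e" "dist (Z N) (F x0) < e" using N by auto
    show "v \<in> reg_subdiff \<theta> (Z N)" unfolding reg_subdiff_iff
    proof (intro conjI allI impI)
      show "\<bar>\<theta> (Z N)\<bar> \<noteq> \<infinity>" by (simp add: tN)
      fix e' :: real assume e': "e' > 0"
      have "((\<lambda>z. dist z (F x0)) \<longlongrightarrow> dist (Z N) (F x0)) (at (Z N))" by (intro tendsto_intros)
      then have "\<forall>\<^sub>F z in at (Z N). dist z (F x0) < r" using N(2) by (auto intro: order_tendstoD)
      moreover have "((\<lambda>z. n / 2 * norm (z - Z N)) \<longlongrightarrow> n / 2 * norm (Z N - Z N)) (at (Z N))"
        by (intro tendsto_intros)
      then have "\<forall>\<^sub>F z in at (Z N). n / 2 * norm (z - Z N) < e'" by (rule order_tendstoD) (use e' in simp)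
      ultimately show "\<forall>\<^sub>F z in at (Z N). \<theta> (Z N) + ereal (v \<bullet> (z - Z N)) \<le> \<theta> z + ereal (e' * norm (z - Z N))"
      proof eventually_elim
        case (elim z)
        \<comment> \<open>The square is expanded exactly: the linear part is the subgradient term,
          and the quadratic remainder, weighted by \<open>n / 2\<close>, is below
          \<open>e' * norm (z - Z N)\<close> near \<open>Z N\<close>.\<close>
        have eq: "?s (z - F (X N)) = ?s (Z N - F (X N)) + 2 * ((Z N - F (X N)) \<bullet> (z - Z N)) + norm (z - Z N) * norm (z - Z N)"
          by (simp add: dot_square_norm[symmetric] power2_eq_square[symmetric] algebra_simps inner_commute)
        have "n / 2 * norm (z - Z N) * norm (z - Z N) \<le> e' * norm (z - Z N)"
          using elim(2) by (intro mult_right_mono) auto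
        moreover have "n / 2 * ?s (z - F (X N)) = n / 2 * ?s (Z N - F (X N)) - v \<bullet> (z - Z N) + n / 2 * norm (z - Z N) * norm (z - Z N)"
          unfolding eq v_def by (simp add: algebra_simps)
        moreover have "t (\<rho> N) + n / 2 * ?s (Z N - F (X N)) \<le> a + n / 2 * ?s (z - F (X N))" if "\<theta> z = ereal a" for a
          using minim[of "X N" z] N(1) elim(1) by (simp add: that)
        ultimately show ?case using nm[of z]
          by (cases "\<theta> z") (simp_all only: tN plus_ereal.simps ereal_less_eq, fastforce+)
      qed
    qed
    fix d
    \<comment> \<open>With \<open>z\<close> frozen at \<open>Z N\<close>, a smooth function plus
      \<open>e * norm (x - x0)\<close> is minimized; by the triangle inequality \<open>X N\<close>
      minimizes \<open>f\<close> up to slope \<open>e\<close>.\<close>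
    define f where "f x = n / 2 * ?s (Z N - F x) - y \<bullet> x" for x
    have "(f has_derivative (\<lambda>d. v \<bullet> F' (X N) d - y \<bullet> d)) (at (X N))"
      unfolding f_def
      by (rule derivative_eq_intros F refl)+ (auto simp: v_def inner_commute algebra_simps)
    moreover have "\<forall>\<^sub>F x in at (X N). f (X N) \<le> f x + e * norm (x - X N)"
    proof -
      have "((\<lambda>x. dist x x0) \<longlongrightarrow> dist (X N) x0) (at (X N))" by (intro tendsto_intros)
      then have "\<forall>\<^sub>F x in at (X N). dist x x0 < r" using N(1) by (auto intro: order_tendstoD)
      then show ?thesis
      proof eventually_elim
        case (elim x)
        have "e * norm (x - x0) \<le> e * (norm (X N - x0) + norm (x - X N))"
          using e by (intro mult_left_mono) (auto intro: norm_triangle_sub simp: norm_minus_commute, norm)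
        then show ?case using minim[of x "Z N"] elim N(2)
          by (simp add: tN f_def algebra_simps)
      qed
    qed
    ultimately have b: "- (e * norm d) \<le> v \<bullet> F' (X N) d - y \<bullet> d" for d
      by (rule derivative_bound_of_local_min)
    \<comment> \<open>Testing with \<open>- d\<close> as well makes the bound two-sided.\<close>
    have "F' (X N) (- d) = - F' (X N) d"
      using F[of "X N"] by (simp add: has_derivative_bounded_linear linear_simps)
    then show "\<bar>v \<bullet> F' (X N) d - y \<bullet> d\<bar> \<le> e * norm d" using b[of d] b[of "- d"] by simp
  qed
qed

text \<open>Common core of three limit passages: multipliers in the first-order chain rule,
  multipliers along the graph of \<open>S\<close> in \<open>coderiv_composite\<close>, and normals
  in the preimage rule. Each time a qualification condition rules out the escaping case.\<close>

lemma multiplier_dichotomy: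
  fixes v :: "nat \<Rightarrow> 'b::euclidean_space" and A :: "nat \<Rightarrow> 'a::euclidean_space \<Rightarrow> 'b"
  assumes A: "\<And>d. (\<lambda>k. A k d) \<longlonglongrightarrow> A0 d" and y: "\<And>d. (\<lambda>k. v k \<bullet> A k d) \<longlonglongrightarrow> y \<bullet> d"
  obtains (convergent) \<rho> vb where "strict_mono \<rho>" "(\<lambda>k. v (\<rho> k)) \<longlonglongrightarrow> vb" "\<And>d. vb \<bullet> A0 d = y \<bullet> d"
    | (escaping) \<rho> \<sigma> vb where "strict_mono \<rho>" "\<And>k. \<sigma> k > (0::real)" "\<sigma> \<longlonglongrightarrow> 0"
      "(\<lambda>k. \<sigma> k *\<^sub>R v (\<rho> k)) \<longlonglongrightarrow> vb" "vb \<noteq> 0" "\<And>d. vb \<bullet> A0 d = 0"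
proof -
  \<comment> \<open>The weights \<open>w k\<close> compactify: \<open>(w k *\<^sub>R v k, w k)\<close> has a limit \<open>(e, w0)\<close> along a subsequence,
    and the two cases are \<open>w0 \<noteq> 0\<close> and \<open>w0 = 0\<close>.\<close>
  define w where "w k = inverse (1 + norm (v k))" for k
  have w: "0 < w k" "w k \<le> 1" "norm (w k *\<^sub>R v k) = 1 - w k" for k
  proof -
    have "1 + norm (v k) > 0" by (simp add: add_pos_nonneg)
    then show "0 < w k" "w k \<le> 1" "norm (w k *\<^sub>R v k) = 1 - w k" by (auto simp: w_def field_simps)
  qed
  have "compact (cball (0::'b) 1 \<times> {0..1::real})" by (intro compact_Times) auto
  moreover have "\<forall>k. (w k *\<^sub>R v k, w k) \<in> cball (0::'b) 1 \<times> {0..1::real}"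
    using w by (simp add: less_imp_le)
  ultimately obtain l \<rho> where \<rho>: "strict_mono \<rho>" "((\<lambda>k. (w k *\<^sub>R v k, w k)) \<circ> \<rho>) \<longlonglongrightarrow> l"
    unfolding compact_def by (metis (no_types, lifting))
  obtain e w0 where l: "l = (e, w0)" by (cases l)
  have e: "(\<lambda>k. w (\<rho> k) *\<^sub>R v (\<rho> k)) \<longlonglongrightarrow> e" and w0: "(\<lambda>k. w (\<rho> k)) \<longlonglongrightarrow> w0"
    using tendsto_fst[OF \<rho>(2)] tendsto_snd[OF \<rho>(2)] by (simp_all add: l o_def)
  have "(\<lambda>k. 1 - w (\<rho> k)) \<longlonglongrightarrow> norm e"
    using tendsto_norm[OF e] unfolding w(3) .
  \<comment> \<open>The limit direction has norm \<open>1 - w0\<close>, hence it cannot vanish when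
    \<open>w0 = 0\<close>.\<close>
  then have ne: "norm e = 1 - w0"
    using tendsto_diff[OF tendsto_const w0, of 1] LIMSEQ_unique by blast
  have A\<rho>: "(\<lambda>k. A (\<rho> k) d) \<longlonglongrightarrow> A0 d" for d by (rule LIMSEQ_subseq_LIMSEQ[OF A \<rho>(1), unfolded o_def])
  have lim: "e \<bullet> A0 d = w0 * (y \<bullet> d)" for d
  proof (rule LIMSEQ_unique)
    show "(\<lambda>k. (w (\<rho> k) *\<^sub>R v (\<rho> k)) \<bullet> A (\<rho> k) d) \<longlonglongrightarrow> e \<bullet> A0 d"
      by (intro tendsto_intros e A\<rho>)
    show "(\<lambda>k. (w (\<rho> k) *\<^sub>R v (\<rho> k)) \<bullet> A (\<rho> k) d) \<longlonglongrightarrow> w0 * (y \<bullet> d)"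
      using tendsto_mult[OF w0 LIMSEQ_subseq_LIMSEQ[OF y \<rho>(1)]] by (simp add: o_def)
  qed
  show thesis
  proof (cases "w0 = 0")
    case True
    then have "e \<noteq> 0" using ne by auto
    then show ?thesis using True escaping[of \<rho> "\<lambda>k. w (\<rho> k)" e] \<rho>(1) w(1) w0 e ne lim by auto
  next
    case False
    have "(\<lambda>k. inverse (w (\<rho> k)) *\<^sub>R (w (\<rho> k) *\<^sub>R v (\<rho> k))) \<longlonglongrightarrow> inverse w0 *\<^sub>R e"
      by (intro tendsto_intros w0 e False)
    then have "(\<lambda>k. v (\<rho> k)) \<longlonglongrightarrow> inverse w0 *\<^sub>R e" using w(1) by (simp add: less_imp_neq[symmetric])
    moreover have "(inverse w0 *\<^sub>R e) \<bullet> A0 d = y \<bullet> d" for d using False by (simp add: lim)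
    ultimately show ?thesis using convergent \<rho>(1) by blast
  qed
qed

subsection \<open>Convex functions\<close>

text \<open>The subdifferential of convex analysis. Being a global inequality, it passes to limits
  by semicontinuity even if convergence of the function values is not known.\<close>

definition convex_subdiff :: "('a::euclidean_space \<Rightarrow> ereal) \<Rightarrow> 'a \<Rightarrow> 'a set" where
  "convex_subdiff \<theta> z = {v. \<bar>\<theta> z\<bar> \<noteq> \<infinity> \<and> (\<forall>z'. \<theta> z + ereal (v \<bullet> (z' - z)) \<le> \<theta> z')}"

lemma convex_funD:
  assumes "convex_fun \<theta>" "\<theta> x \<le> ereal a" "\<theta> y \<le> ereal b" "0 \<le> s" "s \<le> 1"
  shows "\<theta> (x + s *\<^sub>R (y - x)) \<le> ereal (a + s * (b - a))"
proof -
  have "(1 - s) *\<^sub>R (x, a) + s *\<^sub>R (y, b) \<in> {(x, t). \<theta> x \<le> ereal t}"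
    using assms by (intro convexD[OF assms(1)[unfolded convex_fun_def]]) auto
  then show ?thesis by (simp add: algebra_simps)
qed

text \<open>The local inequality at one point \<open>z + s *\<^sub>R (z' - z)\<close> with small
  \<open>s\<close>, combined with convexity along the segment, can be divided by \<open>s\<close>;
  this gives the inequality at \<open>z'\<close> up to an error that tends to 0 with
  \<open>e\<close>.\<close>

lemma reg_subdiff_convex:
  assumes cv: "convex_fun \<theta>" and nm: "\<And>z. \<theta> z \<noteq> -\<infinity>"
  shows "reg_subdiff \<theta> z = convex_subdiff \<theta> z"
proof (intro equalityI subsetI)
  fix v assume "v \<in> convex_subdiff \<theta> z"
  then have v: "\<bar>\<theta> z\<bar> \<noteq> \<infinity>" "\<And>z'. \<theta> z + ereal (v \<bullet> (z' - z)) \<le> \<theta> z'"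
    by (auto simp: convex_subdiff_def)
  show "v \<in> reg_subdiff \<theta> z" unfolding reg_subdiff_iff
  proof (intro conjI v(1) allI impI always_eventually)
    fix e :: real and z' assume "e > 0"
    then have "0 \<le> e * norm (z' - z)" by simp
    then show "\<theta> z + ereal (v \<bullet> (z' - z)) \<le> \<theta> z' + ereal (e * norm (z' - z))"
      using v(1) v(2)[of z'] by (cases "\<theta> z"; cases "\<theta> z'") auto
  qed
next
  fix v assume v: "v \<in> reg_subdiff \<theta> z"
  then have fin: "\<bar>\<theta> z\<bar> \<noteq> \<infinity>" by (simp add: reg_subdiff_def)
  then obtain c where c: "\<theta> z = ereal c" by auto
  have "\<theta> z + ereal (v \<bullet> (z' - z)) \<le> \<theta> z'" for z'
  proof (cases "\<theta> z' = \<infinity> \<or> z' = z")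
    case False
    then obtain t where t: "\<theta> z' = ereal t" using nm[of z'] by (cases "\<theta> z'") auto
    have "v \<bullet> (z' - z) \<le> t - c + e * norm (z' - z)" if e: "e > 0" for e
    proof -
      have "\<forall>\<^sub>F y in at z. \<theta> z + ereal (v \<bullet> (y - z)) \<le> \<theta> y + ereal (e * norm (y - z))"
        using v e by (simp add: reg_subdiff_iff)
      moreover have "filterlim (\<lambda>s. z + s *\<^sub>R (z' - z)) (at z) (at_right 0)"
        unfolding filterlim_at using False
        by (auto intro!: tendsto_eq_intros simp: eventually_at_filter)
      ultimately have "\<forall>\<^sub>F s in at_right 0. \<theta> z + ereal (v \<bullet> (z + s *\<^sub>R (z' - z) - z))
           \<le> \<theta> (z + s *\<^sub>R (z' - z)) + ereal (e * norm (z + s *\<^sub>R (z' - z) - z))"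
        unfolding filterlim_iff by blast
      moreover have "\<forall>\<^sub>F s in at_right (0::real). s \<in> {0<..<1}"
        by (rule eventually_at_right_real) simp
      ultimately have "\<forall>\<^sub>F s in at_right (0::real). s \<in> {0<..<1} \<and> \<theta> z + ereal (v \<bullet> (z + s *\<^sub>R (z' - z) - z))
           \<le> \<theta> (z + s *\<^sub>R (z' - z)) + ereal (e * norm (z + s *\<^sub>R (z' - z) - z))"
        by eventually_elim blast
      then obtain s :: real where s: "0 < s" "s < 1" "\<theta> z + ereal (v \<bullet> (z + s *\<^sub>R (z' - z) - z))
           \<le> \<theta> (z + s *\<^sub>R (z' - z)) + ereal (e * norm (z + s *\<^sub>R (z' - z) - z))"
        by (metis (no_types, lifting) eventually_happens greaterThanLessThan_iff trivial_limit_at_right_real)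
      have "\<theta> (z + s *\<^sub>R (z' - z)) \<le> ereal (c + s * (t - c))"
        by (rule convex_funD[OF cv]) (use c t s in auto)
      then have "c + s * (v \<bullet> (z' - z)) \<le> c + s * (t - c) + e * (s * norm (z' - z))"
        using s c by (cases "\<theta> (z + s *\<^sub>R (z' - z))") auto
      then have "s * (v \<bullet> (z' - z)) \<le> s * (t - c + e * norm (z' - z))" by (simp add: algebra_simps)
      then show ?thesis using s(1) by simp
    qed
    then have "v \<bullet> (z' - z) \<le> t - c + e" if "e > 0" for e
      using that False by (metis divide_pos_pos nonzero_eq_divide_eq norm_eq_zero right_minus_eq zero_less_norm_iff)
    then have "v \<bullet> (z' - z) \<le> t - c" by (rule field_le_epsilon)
    then show ?thesis by (simp add: c t)
  qed auto
  then show "v \<in> convex_subdiff \<theta> z" using fin by (simp add: convex_subdiff_def)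
qed

text \<open>For fixed \<open>z'\<close> in the domain, solve the inequality for
  \<open>\<theta> (zs k)\<close> and pass to the limit by semicontinuity. The domain point
  \<open>z1\<close>, supplied by properness, yields finiteness of \<open>\<theta> z\<close>.\<close>

lemma convex_subdiff_closed:
  assumes pr: "proper_fun \<theta>" and lsc: "lsc_fun \<theta>"
    and z: "zs \<longlonglongrightarrow> z" and v: "vs \<longlonglongrightarrow> v" and mem: "\<And>k. vs k \<in> convex_subdiff \<theta> (zs k)"
  shows "v \<in> convex_subdiff \<theta> z"
proof -
  have nm: "\<theta> x \<noteq> -\<infinity>" for x using pr by (simp add: proper_fun_def)
  have le: "\<theta> z \<le> ereal (t - v \<bullet> (z' - z))" if t: "\<theta> z' = ereal t" for z' t
  proof (rule lsc_le_of_tendsto[OF lsc z])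
    show "(\<lambda>k. ereal (t - vs k \<bullet> (z' - zs k))) \<longlonglongrightarrow> ereal (t - v \<bullet> (z' - z))"
      by (intro tendsto_intros z v)
    fix k
    have "\<theta> (zs k) + ereal (vs k \<bullet> (z' - zs k)) \<le> ereal t" using mem[of k] t[symmetric] by (simp add: convex_subdiff_def)
    then show "\<theta> (zs k) \<le> ereal (t - vs k \<bullet> (z' - zs k))" by (cases "\<theta> (zs k)") auto
  qed
  obtain z1 where "\<theta> z1 \<noteq> \<infinity>" using pr by (auto simp: proper_fun_def)
  then obtain t1 where "\<theta> z1 = ereal t1" using nm[of z1] by (cases "\<theta> z1") auto
  from le[OF this] obtain c where c: "\<theta> z = ereal c" using nm[of z] by (cases "\<theta> z") auto
  have "\<theta> z + ereal (v \<bullet> (z' - z)) \<le> \<theta> z'" for z'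
    using le[of z'] nm[of z'] c by (cases "\<theta> z'") auto
  then show ?thesis by (simp add: convex_subdiff_def c)
qed

text \<open>Regular subgradients of a convex function are already closed under limits, so the
  limiting construction adds nothing.\<close>

lemma subdiff_convex:
  assumes "proper_fun \<theta>" "lsc_fun \<theta>" "convex_fun \<theta>"
  shows "subdiff \<theta> z = convex_subdiff \<theta> z"
proof -
  have reg: "reg_subdiff \<theta> z = convex_subdiff \<theta> z" for z
    using reg_subdiff_convex assms by (auto simp: proper_fun_def)
  show ?thesis
  proof (intro equalityI subsetI)
    fix v assume "v \<in> subdiff \<theta> z"
    then show "v \<in> convex_subdiff \<theta> z"
      unfolding subdiff_def reg using convex_subdiff_closed[OF assms(1,2)] by blast
  next
    fix v assume v: "v \<in> convex_subdiff \<theta> z"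
    then have "\<bar>\<theta> z\<bar> \<noteq> \<infinity>" by (simp add: convex_subdiff_def)
    with v show "v \<in> subdiff \<theta> z" unfolding subdiff_def reg mem_Collect_eq
      by (intro conjI exI[where x = "\<lambda>_. z"] exI[where x = "\<lambda>_. v"]) auto
  qed
qed

lemma closed_graph_subdiff_convex:
  assumes "proper_fun \<theta>" "lsc_fun \<theta>" "convex_fun \<theta>"
  shows "closed (graph (subdiff \<theta>))"
  unfolding closed_sequential_limits
proof (intro allI impI)
  fix s l assume s: "(\<forall>n. s n \<in> graph (subdiff \<theta>)) \<and> s \<longlonglongrightarrow> l"
  then have "(\<lambda>n. fst (s n)) \<longlonglongrightarrow> fst l" "(\<lambda>n. snd (s n)) \<longlonglongrightarrow> snd l" by (auto intro: tendsto_intros)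
  moreover have "snd (s n) \<in> convex_subdiff \<theta> (fst (s n))" for n
    using s by (auto simp: graph_def subdiff_convex[OF assms] split_beta)
  ultimately have "snd l \<in> convex_subdiff \<theta> (fst l)" by (rule convex_subdiff_closed[OF assms(1,2)])
  then show "l \<in> graph (subdiff \<theta>)" by (simp add: graph_def subdiff_convex[OF assms] split_beta)
qed

section \<open>Normals to the domain and singular subgradients\<close>

text \<open>For \<open>z\<close> in the domain this is the normal cone of convex analysis.
  Membership of \<open>z\<close> is left out so that the set makes sense at nearby points where
  \<open>\<theta>\<close> may be infinite.\<close>

definition domain_normals :: "('a::euclidean_space \<Rightarrow> ereal) \<Rightarrow> 'a \<Rightarrow> 'a set" where
  "domain_normals \<theta> z = {v. \<forall>z'. \<theta> z' \<noteq> \<infinity> \<longrightarrow> v \<bullet> (z' - z) \<le> 0}"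

lemma domain_normals_closed:
  assumes "zs \<longlonglongrightarrow> z" "vs \<longlonglongrightarrow> v" "\<And>k. vs k \<in> domain_normals \<theta> (zs k)"
  shows "v \<in> domain_normals \<theta> z"
  unfolding domain_normals_def
proof (clarify)
  fix z' assume z': "\<theta> z' \<noteq> \<infinity>"
  have "(\<lambda>k. vs k \<bullet> (z' - zs k)) \<longlonglongrightarrow> v \<bullet> (z' - z)" by (intro tendsto_intros assms)
  then show "v \<bullet> (z' - z) \<le> 0"
    by (rule LIMSEQ_le_const2) (use assms(3) z' in \<open>auto simp: domain_normals_def\<close>)
qed

text \<open>Semicontinuity bounds \<open>\<theta> (zs k)\<close> below by some \<open>m\<close>, so
  the subgradient inequality multiplied by \<open>\<sigma> k\<close> has right-hand side at most
  \<open>\<sigma> k * (t - m)\<close>, which vanishes.\<close>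

lemma escaping_subgradients_domain_normal:
  assumes pr: "proper_fun \<theta>" and lsc: "lsc_fun \<theta>"
    and z: "zs \<longlonglongrightarrow> z" and mem: "\<And>k. vs k \<in> convex_subdiff \<theta> (zs k)"
    and s: "\<And>k. \<sigma> k > (0::real)" "\<sigma> \<longlonglongrightarrow> 0" and v: "(\<lambda>k. \<sigma> k *\<^sub>R vs k) \<longlonglongrightarrow> v"
  shows "v \<in> domain_normals \<theta> z"
  unfolding domain_normals_def
proof (clarify)
  have nm: "\<theta> x \<noteq> -\<infinity>" for x using pr by (simp add: proper_fun_def)
  fix z' assume "\<theta> z' \<noteq> \<infinity>"
  then obtain t where t: "\<theta> z' = ereal t" using nm[of z'] by (cases "\<theta> z'") auto
  obtain m where m: "ereal m < \<theta> z" using nm[of z] by (metis MInfty_neq_ereal(1) ereal_infty_less(2) ereal_dense2)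
  have ev: "\<forall>\<^sub>F k in sequentially. ereal m < \<theta> (zs k)"
    using lsc_fun_eventually[OF lsc m] z filterlim_iff by blast
  have "(\<lambda>k. (\<sigma> k *\<^sub>R vs k) \<bullet> (z' - zs k)) \<longlonglongrightarrow> v \<bullet> (z' - z)" by (intro tendsto_intros z v)
  moreover have "(\<lambda>k. \<sigma> k * (t - m)) \<longlonglongrightarrow> 0 * (t - m)" by (intro tendsto_intros s)
  moreover have "\<forall>\<^sub>F k in sequentially. (\<sigma> k *\<^sub>R vs k) \<bullet> (z' - zs k) \<le> \<sigma> k * (t - m)"
    using ev
  proof eventually_elim
    case (elim k)
    have "\<theta> (zs k) + ereal (vs k \<bullet> (z' - zs k)) \<le> ereal t"
      using mem[of k] t[symmetric] by (simp add: convex_subdiff_def)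
    then have "vs k \<bullet> (z' - zs k) \<le> t - m" using elim by (cases "\<theta> (zs k)") auto
    then show ?case using s(1)[of k] by simp
  qed
  ultimately show "v \<bullet> (z' - z) \<le> 0"
    using tendsto_le[OF sequentially_bot] by fastforce
qed

text \<open>For \<open>v\<close> normal to the domain at \<open>z\<close>, the proximal points \<open>Z k\<close> of \<open>z + v\<close> with parameter \<open>s k \<longlonglongrightarrow> 0\<close>
  carry the subgradients \<open>(z + v - Z k) / s k\<close>. Normality keeps \<open>\<theta> (Z k) \<le> \<theta> z\<close>, whence \<open>Z k\<close> tends to \<open>z\<close>
  \<open>\<theta>\<close>-attentively.\<close>

lemma domain_normals_subset_sing_subdiff:
  assumes pr: "proper_fun \<theta>" and lsc: "lsc_fun \<theta>" and cv: "convex_fun \<theta>" and fin: "\<bar>\<theta> z\<bar> \<noteq> \<infinity>"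
  shows "domain_normals \<theta> z \<subseteq> sing_subdiff \<theta> z"
proof
  fix v assume v: "v \<in> domain_normals \<theta> z"
  have nm: "\<theta> x \<noteq> -\<infinity>" for x using pr by (simp add: proper_fun_def)
  obtain c where c: "\<theta> z = ereal c" using fin by auto
  obtain zm where zm: "zm \<in> cball z 1" "\<And>x. x \<in> cball z 1 \<Longrightarrow> \<theta> zm \<le> \<theta> x"
    by (rule lsc_attains_inf_compact[of "cball z 1" \<theta>]) (use lsc_fun_eventually[OF lsc] in auto)
  have "\<theta> zm \<le> ereal c" using zm(2)[of z] by (simp add: c)
  then obtain m where m: "\<theta> zm = ereal m" "m \<le> c" using nm[of zm] by (cases "\<theta> zm") auto
  \<comment> \<open>Chosen so that \<open>s k\<close> tends to 0 and
    \<open>2 * s k * (c - m) < 1\<close>; the latter puts \<open>Z k\<close> inside the open ball,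
    where minimality over the closed ball is local minimality.\<close>
  define s where "s k = inverse (2 * (c - m) + 2 + real k)" for k
  have s: "s k > 0" "2 * s k * (c - m) < 1" for k
    using m(2) by (auto simp: s_def field_simps)
  have s0: "s \<longlonglongrightarrow> 0" unfolding s_def
    by (intro tendsto_inverse_0_at_top filterlim_tendsto_add_at_top[OF tendsto_const] filterlim_real_sequentially)
  define g where "g k x = (x - z - v) \<bullet> (x - z - v) / (2 * s k)" for k x
  have "\<exists>x. x \<in> cball z 1 \<and> (\<forall>y\<in>cball z 1. \<theta> x + ereal (g k x) \<le> \<theta> y + ereal (g k y))" for k
  proof (rule lsc_attains_inf_compact[of "cball z 1" "\<lambda>x. \<theta> x + ereal (g k x)"])
    fix x b assume b: "b < \<theta> x + ereal (g k x)"
    have cont: "isCont (g k) x"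
      unfolding g_def using s(1)[of k] by (intro continuous_intros) auto
    show "\<forall>\<^sub>F y in nhds x. b < \<theta> y + ereal (g k y)"
      by (rule lsc_add_continuous[OF lsc_fun_eventually[OF lsc] nm cont b])
  qed auto
  then obtain Z where Z: "\<And>k. Z k \<in> cball z 1"
    "\<And>k y. y \<in> cball z 1 \<Longrightarrow> \<theta> (Z k) + ereal (g k (Z k)) \<le> \<theta> y + ereal (g k y)" by metis
  define t where "t k = real_of_ereal (\<theta> (Z k))" for k
  have t: "\<theta> (Z k) = ereal (t k)" for k
    using Z(2)[of z k] nm[of "Z k"] by (cases "\<theta> (Z k)") (auto simp: t_def c)
  \<comment> \<open>Comparison with the value at \<open>z\<close>: in the expanded square the cross
    term with \<open>v\<close> has a favorable sign, because \<open>v\<close> is normal and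
    \<open>Z k\<close> lies in the domain.\<close>
  have key: "t k + (norm (Z k - z))\<^sup>2 / (2 * s k) \<le> c" for k
  proof -
    have "v \<bullet> (Z k - z) \<le> 0" using v t[of k] by (auto simp: domain_normals_def)
    then have "(norm (Z k - z))\<^sup>2 + v \<bullet> v \<le> (Z k - z - v) \<bullet> (Z k - z - v)"
      by (simp add: power2_norm_eq_inner algebra_simps inner_commute)
    then have "((norm (Z k - z))\<^sup>2 + v \<bullet> v) / (2 * s k) \<le> g k (Z k)"
      unfolding g_def using s(1)[of k] by (intro divide_right_mono) auto
    moreover have "t k + g k (Z k) \<le> c + v \<bullet> v / (2 * s k)"
      using Z(2)[of z k] by (simp add: t c g_def)
    ultimately show ?thesis by (simp add: add_divide_distrib)
  qed
  have mt: "m \<le> t k" for k using zm(2)[OF Z(1)[of k]] by (simp add: m t)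
  have dist: "(norm (Z k - z))\<^sup>2 \<le> 2 * s k * (c - m)" for k
  proof -
    have "(norm (Z k - z))\<^sup>2 / (2 * s k) \<le> c - m" using key[of k] mt[of k] by linarith
    then show ?thesis using s(1)[of k] by (simp add: pos_divide_le_eq mult_ac)
  qed
  have Zlim: "Z \<longlonglongrightarrow> z"
  proof -
    have "(\<lambda>k. 2 * s k * (c - m)) \<longlonglongrightarrow> 2 * 0 * (c - m)" by (intro tendsto_intros s0)
    then have "(\<lambda>k. 2 * s k * (c - m)) \<longlonglongrightarrow> 0" by simp
    then have "(\<lambda>k. (norm (Z k - z))\<^sup>2) \<longlonglongrightarrow> 0"
      by (rule Lim_null_comparison[rotated]) (use dist in auto)
    then show ?thesis by (simp add: tendsto_norm_zero_iff LIM_zero_iff)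
  qed
  have tc: "t k \<le> c" for k using key[of k] s(1)[of k] by (smt (verit) divide_nonneg_pos zero_le_power2)
  have tlim: "(\<lambda>k. \<theta> (Z k)) \<longlonglongrightarrow> \<theta> z"
  proof (rule order_tendstoI)
    fix a assume "a < \<theta> z"
    then show "\<forall>\<^sub>F k in sequentially. a < \<theta> (Z k)"
      using lsc_fun_eventually[OF lsc] Zlim filterlim_iff by blast
  next
    fix a assume "\<theta> z < a"
    then show "\<forall>\<^sub>F k in sequentially. \<theta> (Z k) < a"
      using tc by (intro always_eventually allI) (metis c ereal_less_eq(3) le_less_trans t)
  qed
  \<comment> \<open>Minus the gradient of the quadratic \<open>g k\<close> at \<open>Z k\<close>;
    multiplied by \<open>s k\<close> it is \<open>z + v - Z k\<close>, which tends to
    \<open>v\<close>.\<close>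
  define vs where "vs k = inverse (s k) *\<^sub>R (z + v - Z k)" for k
  have "vs k \<in> reg_subdiff \<theta> (Z k)" for k
    unfolding reg_subdiff_iff
  proof (intro conjI allI impI)
    show "\<bar>\<theta> (Z k)\<bar> \<noteq> \<infinity>" by (simp add: t)
    fix e' :: real assume e': "e' > 0"
    have "(norm (Z k - z))\<^sup>2 < 1" using dist[of k] s(2)[of k] by simp
    then have lt: "dist (Z k) z < 1" by (simp add: dist_norm power_less_one_iff abs_square_less_1)
    have "((\<lambda>x. dist x z) \<longlongrightarrow> dist (Z k) z) (at (Z k))" by (intro tendsto_intros)
    then have "\<forall>\<^sub>F x in at (Z k). dist x z < 1" using lt by (auto intro: order_tendstoD)
    moreover have "((\<lambda>x. norm (x - Z k) / (2 * s k)) \<longlongrightarrow> norm (Z k - Z k) / (2 * s k)) (at (Z k))"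
      using s(1)[of k] by (intro tendsto_intros) auto
    then have "\<forall>\<^sub>F x in at (Z k). norm (x - Z k) / (2 * s k) < e'" by (rule order_tendstoD) (use e' in simp)
    ultimately show "\<forall>\<^sub>F x in at (Z k). \<theta> (Z k) + ereal (vs k \<bullet> (x - Z k)) \<le> \<theta> x + ereal (e' * norm (x - Z k))"
    proof eventually_elim
      case (elim x)
      have "(x - z - v) \<bullet> (x - z - v) = (Z k - z - v) \<bullet> (Z k - z - v) - 2 * ((z + v - Z k) \<bullet> (x - Z k)) + norm (x - Z k) * norm (x - Z k)"
        by (simp add: dot_square_norm[symmetric] power2_eq_square[symmetric] algebra_simps inner_commute)
      then have "g k x = g k (Z k) - vs k \<bullet> (x - Z k) + norm (x - Z k) / (2 * s k) * norm (x - Z k)"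
        unfolding g_def vs_def inner_scaleR_left using s(1)[of k] by (simp only:) (simp add: field_simps)
      moreover have "norm (x - Z k) / (2 * s k) * norm (x - Z k) \<le> e' * norm (x - Z k)"
        using elim(2) by (intro mult_right_mono) auto
      ultimately show ?case using Z(2)[of x k] elim(1) nm[of x]
        by (cases "\<theta> x") (auto simp: t dist_commute)
    qed
  qed
  moreover have "(\<lambda>k. s k *\<^sub>R vs k) \<longlonglongrightarrow> v"
  proof -
    have "(\<lambda>k. z + v - Z k) \<longlonglongrightarrow> z + v - z" by (intro tendsto_intros Zlim)
    then show ?thesis using s(1) by (simp add: vs_def less_imp_neq[symmetric])
  qed
  ultimately show "v \<in> sing_subdiff \<theta> z"
    unfolding sing_subdiff_def using fin s(1) s0 Zlim tlim by blast
qed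

subsection \<open>Chain rule for amenable functions\<close>

lemma tendsto_of_dist_le:
  fixes f g :: "nat \<Rightarrow> 'a::metric_space"
  assumes "f \<longlonglongrightarrow> l" "e \<longlonglongrightarrow> 0" "\<And>k. dist (g k) (f k) \<le> e k"
  shows "g \<longlonglongrightarrow> l"
proof -
  have "(\<lambda>k. e k + dist (f k) l) \<longlonglongrightarrow> 0"
    by (rule tendsto_add_zero[OF assms(2)]) (use assms(1) tendsto_dist_iff in blast)
  moreover have "norm (dist (g k) l) \<le> e k + dist (f k) l" for k
    using assms(3)[of k] dist_triangle[of "g k" l "f k"] by simp
  ultimately have "(\<lambda>k. dist (g k) l) \<longlonglongrightarrow> 0"
    using Lim_null_comparison[OF always_eventually, of "\<lambda>k. dist (g k) l" "\<lambda>k. e k + dist (f k) l"] by blast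
  then show ?thesis using tendsto_dist_iff by blast
qed

section \<open>Locality of subdifferentials\<close>

lemma reg_subdiff_local:
  assumes "open U" "x \<in> U" "\<And>x. x \<in> U \<Longrightarrow> \<psi> x = \<psi>' x" "v \<in> reg_subdiff \<psi> x"
  shows "v \<in> reg_subdiff \<psi>' x"
proof -
  have U: "\<forall>\<^sub>F y in at x. y \<in> U"
    using assms(1,2) by (simp add: eventually_at_topological) blast
  have "\<forall>\<^sub>F y in at x. \<psi>' x + ereal (v \<bullet> (y - x)) \<le> \<psi>' y + ereal (e * norm (y - x))" if "e > 0" for e
  proof -
    have "\<forall>\<^sub>F y in at x. \<psi> x + ereal (v \<bullet> (y - x)) \<le> \<psi> y + ereal (e * norm (y - x))"
      using assms(4) that by (simp add: reg_subdiff_iff)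
    with U show ?thesis
      by eventually_elim (use assms(2,3) in auto)
  qed
  then show ?thesis using assms unfolding reg_subdiff_iff by auto
qed

lemma subdiff_local:
  assumes "open U" "x \<in> U" "\<And>x. x \<in> U \<Longrightarrow> \<psi> x = \<psi>' x" "v \<in> subdiff \<psi> x"
  shows "v \<in> subdiff \<psi>' x"
proof -
  from assms(4) obtain xs vs where s: "\<bar>\<psi> x\<bar> \<noteq> \<infinity>" "xs \<longlonglongrightarrow> x" "(\<lambda>k. \<psi> (xs k)) \<longlonglongrightarrow> \<psi> x"
    "\<And>k. vs k \<in> reg_subdiff \<psi> (xs k)" "vs \<longlonglongrightarrow> v"
    unfolding subdiff_def mem_Collect_eq by metis
  have "\<forall>\<^sub>F k in sequentially. xs k \<in> U" using s(2) assms(1,2) by (rule topological_tendstoD)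
  then obtain N where N: "\<And>k. k \<ge> N \<Longrightarrow> xs k \<in> U" by (auto simp: eventually_sequentially)
  let ?xs = "\<lambda>k. xs (k + N)" and ?vs = "\<lambda>k. vs (k + N)"
  have "?xs \<longlonglongrightarrow> x" "?vs \<longlonglongrightarrow> v" "(\<lambda>k. \<psi> (?xs k)) \<longlonglongrightarrow> \<psi> x"
    using s(2,3,5) by (auto intro: LIMSEQ_ignore_initial_segment[of _ _ N] LIMSEQ_ignore_initial_segment[of "\<lambda>k. \<psi> (xs k)" _ N])
  moreover have "\<psi> (?xs k) = \<psi>' (?xs k)" for k using assms(3) N by simp
  moreover have "?vs k \<in> reg_subdiff \<psi>' (?xs k)" for k
    using reg_subdiff_local[OF assms(1) _ assms(3) s(4)] N by simp
  ultimately show ?thesis using s(1) assms(3)[OF assms(2)] unfolding subdiff_def mem_Collect_eq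
    by (intro conjI exI[of _ ?xs] exI[of _ ?vs]) auto
qed

lemma subdiff_cong_open:
  assumes "open U" "x \<in> U" "\<And>x. x \<in> U \<Longrightarrow> \<psi> x = \<psi>' x"
  shows "subdiff \<psi> x = subdiff \<psi>' x"
  using subdiff_local[OF assms] subdiff_local[OF assms(1,2), of \<psi>' \<psi>] assms(3) by fastforce

lemma reg_subdiff_subset_subdiff: "reg_subdiff \<psi> x \<subseteq> subdiff \<psi> x"
proof
  fix v assume v: "v \<in> reg_subdiff \<psi> x"
  then have "\<bar>\<psi> x\<bar> \<noteq> \<infinity>" by (simp add: reg_subdiff_def)
  with v show "v \<in> subdiff \<psi> x" unfolding subdiff_def mem_Collect_eq
    by (intro conjI exI[where x = "\<lambda>_. x"] exI[where x = "\<lambda>_. v"]) auto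
qed

section \<open>First-order chain rule\<close>

text \<open>The global subgradient inequality is evaluated at \<open>F x'\<close>, and the
  linearization error of \<open>F\<close> is absorbed into \<open>e * norm (x' - x)\<close>.\<close>

lemma chain_rule_superset:
  fixes F :: "'a::euclidean_space \<Rightarrow> 'b::euclidean_space"
  assumes v: "v \<in> convex_subdiff \<theta> (F x)" and F: "(F has_derivative F') (at x)"
    and y: "\<And>d. v \<bullet> F' d = y \<bullet> d"
  shows "y \<in> subdiff (\<lambda>x. \<theta> (F x)) x"
proof -
  have fin: "\<bar>\<theta> (F x)\<bar> \<noteq> \<infinity>" and le: "\<And>z. \<theta> (F x) + ereal (v \<bullet> (z - F x)) \<le> \<theta> z"
    using v by (auto simp: convex_subdiff_def)
  have "y \<in> reg_subdiff (\<lambda>x. \<theta> (F x)) x" unfolding reg_subdiff_iff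
  proof (intro conjI fin allI impI)
    fix e :: real assume e: "e > 0"
    have v1: "norm v + 1 > 0" by (simp add: add_nonneg_pos)
    \<comment> \<open>The summand 1 keeps the tolerance meaningful when
      \<open>v = 0\<close>.\<close>
    then have "e / (norm v + 1) > 0" using e by simp
    then obtain r where r: "r > 0" "\<And>x'. norm (x' - x) < r \<Longrightarrow>
        norm (F x' - F x - F' (x' - x)) \<le> e / (norm v + 1) * norm (x' - x)"
      using F unfolding has_derivative_at_alt by blast
    show "\<forall>\<^sub>F x' in at x. \<theta> (F x) + ereal (y \<bullet> (x' - x)) \<le> \<theta> (F x') + ereal (e * norm (x' - x))"
      unfolding eventually_at
    proof (intro exI[of _ r] conjI r(1) ballI impI)
      fix x' assume "x' \<noteq> x \<and> dist x' x < r"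
      then have b: "norm (F x' - F x - F' (x' - x)) \<le> e / (norm v + 1) * norm (x' - x)"
        using r(2) by (simp add: dist_norm)
      have "- (v \<bullet> (F x' - F x - F' (x' - x))) \<le> norm v * norm (F x' - F x - F' (x' - x))"
        by (rule order_trans[OF _ Cauchy_Schwarz_ineq2]) simp
      also have "\<dots> \<le> norm v * (e / (norm v + 1) * norm (x' - x))"
        by (intro mult_left_mono b) simp
      also have "\<dots> \<le> e * norm (x' - x)"
      proof -
        have "norm v * (e / (norm v + 1)) \<le> e" using v1 e by (simp add: field_simps)
        then have "norm v * (e / (norm v + 1)) * norm (x' - x) \<le> e * norm (x' - x)"
          by (rule mult_right_mono) simp
        then show ?thesis by (simp only: mult.assoc)
      qed
      finally have "y \<bullet> (x' - x) \<le> v \<bullet> (F x' - F x) + e * norm (x' - x)"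
        using y[of "x' - x"] by (simp add: inner_diff_right)
      then show "\<theta> (F x) + ereal (y \<bullet> (x' - x)) \<le> \<theta> (F x') + ereal (e * norm (x' - x))"
        using le[of "F x'"] fin by (cases "\<theta> (F x)"; cases "\<theta> (F x')") auto
    qed
  qed
  then show ?thesis using reg_subdiff_subset_subdiff by blast
qed

text \<open>The fuzzy rule gives multipliers \<open>V k\<close> that are correct up to
  \<open>inverse (real (Suc k))\<close>. Escaping ones would produce a nonzero domain normal
  annihilating the range of \<open>F' x0\<close>, against \<open>qual\<close>.\<close>

lemma chain_rule_subset:
  fixes F :: "'a::euclidean_space \<Rightarrow> 'b::euclidean_space" and F' :: "'a \<Rightarrow> 'a \<Rightarrow>\<^sub>L 'b"
  assumes theta: "proper_fun \<theta>" "lsc_fun \<theta>" "convex_fun \<theta>"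
    and F: "\<And>x. (F has_derivative blinfun_apply (F' x)) (at x)" and cont: "isCont F' x0"
    and qual: "\<forall>v\<in>domain_normals \<theta> (F x0). (\<forall>d. v \<bullet> F' x0 d = 0) \<longrightarrow> v = 0"
    and y: "y \<in> subdiff (\<lambda>x. \<theta> (F x)) x0"
  shows "\<exists>v\<in>convex_subdiff \<theta> (F x0). \<forall>d. v \<bullet> F' x0 d = y \<bullet> d"
proof -
  have nm: "\<theta> z \<noteq> -\<infinity>" for z using theta by (simp add: proper_fun_def)
  obtain xs ys where s: "xs \<longlonglongrightarrow> x0" "\<And>k. ys k \<in> reg_subdiff (\<lambda>x. \<theta> (F x)) (xs k)" "ys \<longlonglongrightarrow> y"
    using y unfolding subdiff_def by blast
  let ?e = "\<lambda>k. inverse (real (Suc k))"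
  have "\<exists>x z v. dist x (xs k) < ?e k \<and> dist z (F (xs k)) < ?e k \<and> v \<in> reg_subdiff \<theta> z \<and>
      (\<forall>d. \<bar>v \<bullet> F' x d - ys k \<bullet> d\<bar> \<le> ?e k * norm d)" for k
    by (rule fuzzy_chain_rule[OF theta(2) nm F s(2)[of k], of "?e k"]) (simp, blast)
  then obtain X Z V where c: "\<And>k. dist (X k) (xs k) < ?e k" "\<And>k. dist (Z k) (F (xs k)) < ?e k"
     "\<And>k. V k \<in> reg_subdiff \<theta> (Z k)" "\<And>k d. \<bar>V k \<bullet> F' (X k) d - ys k \<bullet> d\<bar> \<le> ?e k * norm d"
    by metis
  have contF: "isCont F x0" using F has_derivative_continuous by metis
  have X: "X \<longlonglongrightarrow> x0"
    by (rule tendsto_of_dist_le[OF s(1) LIMSEQ_inverse_real_of_nat less_imp_le[OF c(1)]])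
  have Z: "Z \<longlonglongrightarrow> F x0"
    by (rule tendsto_of_dist_le[OF isCont_tendsto_compose[OF contF s(1)] LIMSEQ_inverse_real_of_nat less_imp_le[OF c(2)]])
  have V: "V k \<in> convex_subdiff \<theta> (Z k)" for k
    using c(3) reg_subdiff_convex[OF theta(3) nm] by simp
  have F'lim: "(\<lambda>k. F' (X k) d) \<longlonglongrightarrow> F' x0 d" for d
    by (intro tendsto_intros isCont_tendsto_compose[OF cont X])
  have Vlim: "(\<lambda>k. V k \<bullet> F' (X k) d) \<longlonglongrightarrow> y \<bullet> d" for d
  proof (rule tendsto_of_dist_le)
    show "(\<lambda>k. ys k \<bullet> d) \<longlonglongrightarrow> y \<bullet> d" by (intro tendsto_intros s)
    show "(\<lambda>k. ?e k * norm d) \<longlonglongrightarrow> 0"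
      by (rule tendsto_mult_left_zero[OF LIMSEQ_inverse_real_of_nat])
    show "dist (V k \<bullet> F' (X k) d) (ys k \<bullet> d) \<le> ?e k * norm d" for k
      using c(4) by (simp add: dist_real_def)
  qed
  from F'lim Vlim show ?thesis
  proof (cases rule: multiplier_dichotomy)
    case (convergent \<rho> vb)
    have "vb \<in> convex_subdiff \<theta> (F x0)"
      by (rule convex_subdiff_closed[OF theta(1,2) LIMSEQ_subseq_LIMSEQ[OF Z convergent(1), unfolded o_def] convergent(2) V])
    then show ?thesis using convergent(3) by blast
  next
    case (escaping \<rho> \<sigma> vb)
    have "vb \<in> domain_normals \<theta> (F x0)"
      by (rule escaping_subgradients_domain_normal[OF theta(1,2) LIMSEQ_subseq_LIMSEQ[OF Z escaping(1), unfolded o_def] V escaping(2,3,4)])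
    then show ?thesis using qual escaping(5,6) by blast
  qed
qed

text \<open>Otherwise violating normals at points tending to \<open>pb\<close> could be scaled to
  norm 1, and a limit on the unit sphere would violate the condition at \<open>pb\<close>.\<close>

lemma domain_qualification_robust:
  fixes A :: "'p::euclidean_space \<Rightarrow> 'a::euclidean_space \<Rightarrow>\<^sub>L 'b::euclidean_space"
  assumes g: "isCont g pb" and A: "isCont A pb"
    and qual: "\<forall>v\<in>domain_normals \<theta> (g pb). (\<forall>d. v \<bullet> A pb d = 0) \<longrightarrow> v = 0"
  shows "\<forall>\<^sub>F p in nhds pb. \<forall>v \<in> domain_normals \<theta> (g p). (\<forall>d. v \<bullet> A p d = 0) \<longrightarrow> v = 0"
proof (rule ccontr)
  assume no: "\<not> ?thesis"
  have "\<exists>p v. dist p pb < inverse (real (Suc k)) \<and> v \<in> domain_normals \<theta> (g p) \<and> (\<forall>d. v \<bullet> A p d = 0) \<and> norm v = 1" for k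
  proof -
    obtain p v where p: "dist p pb < inverse (real (Suc k))" "v \<in> domain_normals \<theta> (g p)" "\<forall>d. v \<bullet> A p d = 0" "v \<noteq> 0"
      using no unfolding eventually_nhds_metric by (metis inverse_positive_iff_positive of_nat_0_less_iff zero_less_Suc)
    have "inverse (norm v) *\<^sub>R v \<in> domain_normals \<theta> (g p)"
      using p(2) by (auto simp: domain_normals_def intro: mult_nonneg_nonpos)
    then show ?thesis using p by (intro exI[of _ p] exI[of _ "inverse (norm v) *\<^sub>R v"]) auto
  qed
  then obtain P V where P: "\<And>k. dist (P k) pb < inverse (real (Suc k))" "\<And>k. V k \<in> domain_normals \<theta> (g (P k))"
     "\<And>k d. V k \<bullet> A (P k) d = 0" "\<And>k. norm (V k) = 1" by metis
  have "\<forall>k. V k \<in> sphere 0 1" using P(4) by simp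
  then obtain l \<rho> where l: "l \<in> sphere 0 1" "strict_mono \<rho>" "(V \<circ> \<rho>) \<longlonglongrightarrow> l"
    using compact_sphere[of "0::'b" 1] unfolding compact_def by metis
  have "P \<longlonglongrightarrow> pb"
    by (rule tendsto_of_dist_le[OF tendsto_const LIMSEQ_inverse_real_of_nat less_imp_le[OF P(1)]])
  then have P\<rho>: "(\<lambda>k. P (\<rho> k)) \<longlonglongrightarrow> pb" using LIMSEQ_subseq_LIMSEQ[OF _ l(2)] by (auto simp: o_def)
  have V\<rho>: "(\<lambda>k. V (\<rho> k)) \<longlonglongrightarrow> l" using l(3) by (simp add: o_def)
  have "l \<in> domain_normals \<theta> (g pb)"
    by (rule domain_normals_closed[OF isCont_tendsto_compose[OF g P\<rho>] V\<rho> P(2)])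
  moreover have "l \<bullet> A pb d = 0" for d
  proof (rule LIMSEQ_unique)
    show "(\<lambda>k. V (\<rho> k) \<bullet> A (P (\<rho> k)) d) \<longlonglongrightarrow> l \<bullet> A pb d"
      by (intro tendsto_intros V\<rho> isCont_tendsto_compose[OF A P\<rho>])
    show "(\<lambda>k. V (\<rho> k) \<bullet> A (P (\<rho> k)) d) \<longlonglongrightarrow> 0" by (simp add: P(3))
  qed
  ultimately have "l = 0" using qual by blast
  then show False using l(1) by simp
qed

subsection \<open>Coderivative of a composite subgradient mapping\<close>

text \<open>\<open>\<xi>\<close> is the image of \<open>\<zeta>\<close> under the adjoint of
  \<open>F'\<close>. Insert \<open>F s'\<close> into the normal inequality at \<open>F s\<close> and
  expand \<open>F\<close> to first order.\<close>

lemma reg_normal_cone_pullback: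
  fixes F :: "'a::euclidean_space \<Rightarrow> 'b::euclidean_space"
  assumes F: "(F has_derivative F') (at s)" and s: "s \<in> Q"
    and maps: "\<forall>\<^sub>F s' in at s within Q. F s' \<in> \<Omega>"
    and n: "\<zeta> \<in> reg_normal_cone (F s) \<Omega>"
    and \<xi>: "\<And>d. \<xi> \<bullet> d = \<zeta> \<bullet> F' d"
  shows "\<xi> \<in> reg_normal_cone s Q"
  unfolding reg_normal_cone_iff
proof (intro conjI s allI impI)
  fix e :: real assume e: "e > 0"
  obtain C where C: "C > 0" "\<And>d. norm (F' d) \<le> norm d * C"
    using bounded_linear.pos_bounded[OF has_derivative_bounded_linear[OF F]] by blast
  \<comment> \<open>\<open>e1\<close> and \<open>e2\<close> take half of \<open>e\<close> each:
    \<open>e1\<close> is weighted by the local Lipschitz bound \<open>C + 1\<close> of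
    \<open>F\<close> at \<open>s\<close>, \<open>e2\<close> by \<open>norm \<zeta>\<close>. Since
    \<open>e2 \<le> 1\<close>, the linearization error adds at most 1 to \<open>C\<close>.\<close>
  define e1 where "e1 = e / (2 * (C + 1))"
  define e2 where "e2 = min 1 (e / (2 * (norm \<zeta> + 1)))"
  have z1: "norm \<zeta> + 1 > 0" by (simp add: add_nonneg_pos)
  have e12: "e1 > 0" "e2 > 0" "e2 \<le> 1" "e1 * (C + 1) = e / 2" "norm \<zeta> * e2 \<le> e / 2"
  proof -
    show "e1 > 0" "e2 > 0" "e2 \<le> 1" "e1 * (C + 1) = e / 2" using e C z1 by (auto simp: e1_def e2_def field_simps)
    have "norm \<zeta> * e2 \<le> norm \<zeta> * (e / (2 * (norm \<zeta> + 1)))" by (intro mult_left_mono) (auto simp: e2_def)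
    also have "\<dots> \<le> e / 2" using z1 e by (simp add: field_simps)
    finally show "norm \<zeta> * e2 \<le> e / 2" .
  qed
  have "\<forall>\<^sub>F w in at (F s) within \<Omega>. \<zeta> \<bullet> (w - F s) \<le> e1 * norm (w - F s)"
    using n e12(1) by (simp add: reg_normal_cone_iff)
  then obtain r1 where r1: "r1 > 0" "\<And>w. w \<in> \<Omega> \<Longrightarrow> w \<noteq> F s \<Longrightarrow> dist w (F s) < r1 \<Longrightarrow> \<zeta> \<bullet> (w - F s) \<le> e1 * norm (w - F s)"
    unfolding eventually_at by auto
  obtain r2 where r2: "r2 > 0" "\<And>s'. norm (s' - s) < r2 \<Longrightarrow> norm (F s' - F s - F' (s' - s)) \<le> e2 * norm (s' - s)"
    using F e12(2) unfolding has_derivative_at_alt by blast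
  have "\<forall>\<^sub>F s' in at s within Q. dist s' s < min r2 (r1 / (C + 1))"
    unfolding eventually_at using r1(1) r2(1) C(1) by (intro exI[of _ "min r2 (r1 / (C + 1))"]) auto
  with maps show "\<forall>\<^sub>F s' in at s within Q. \<xi> \<bullet> (s' - s) \<le> e * norm (s' - s)"
  proof eventually_elim
    case (elim s')
    let ?d = "s' - s"
    have rem: "norm (F s' - F s - F' ?d) \<le> e2 * norm ?d" using elim r2(2) by (simp add: dist_norm)
    have "norm (F s' - F s) \<le> norm (F s' - F s - F' ?d) + norm (F' ?d)" by norm
    also have "\<dots> \<le> 1 * norm ?d + norm ?d * C"
      using rem C(2)[of ?d] mult_right_mono[OF e12(3) norm_ge_zero[of ?d]] by linarith
    finally have L: "norm (F s' - F s) \<le> (C + 1) * norm ?d" by (simp add: algebra_simps)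
    have "(C + 1) * norm ?d < r1" using elim C(1) by (simp add: dist_norm field_simps)
    then have "dist (F s') (F s) < r1" using L by (simp add: dist_norm)
    then have "\<zeta> \<bullet> (F s' - F s) \<le> e1 * norm (F s' - F s)"
      using r1(2)[OF elim(1)] by (cases "F s' = F s") auto
    also have "\<dots> \<le> e1 * ((C + 1) * norm ?d)" using L e12(1) by (intro mult_left_mono) auto
    also have "\<dots> = e / 2 * norm ?d" using e12(4) by (metis mult.assoc)
    finally have 1: "\<zeta> \<bullet> (F s' - F s) \<le> e / 2 * norm ?d" .
    have "- (\<zeta> \<bullet> (F s' - F s - F' ?d)) \<le> norm \<zeta> * norm (F s' - F s - F' ?d)"
      by (rule order_trans[OF _ Cauchy_Schwarz_ineq2]) simp
    also have "\<dots> \<le> norm \<zeta> * (e2 * norm ?d)" by (intro mult_left_mono rem) simp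
    also have "\<dots> \<le> e / 2 * norm ?d" using mult_right_mono[OF e12(5) norm_ge_zero[of ?d]] by (simp add: mult.assoc)
    finally have 2: "- (\<zeta> \<bullet> (F s' - F s - F' ?d)) \<le> e / 2 * norm ?d" .
    have "\<xi> \<bullet> ?d = \<zeta> \<bullet> (F s' - F s) - \<zeta> \<bullet> (F s' - F s - F' ?d)" unfolding \<xi> by (simp add: inner_diff_right)
    then show ?case using 1 2 by linarith
  qed
qed

lemma reg_normal_cone_scaleR:
  assumes "v \<in> reg_normal_cone x \<Omega>" "c > 0"
  shows "c *\<^sub>R v \<in> reg_normal_cone x \<Omega>"
  unfolding reg_normal_cone_iff
proof (intro conjI allI impI)
  show "x \<in> \<Omega>" using assms by (simp add: reg_normal_cone_def)
  fix e :: real assume "e > 0"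
  then have "e / c > 0" using assms(2) by simp
  then have "\<forall>\<^sub>F y in at x within \<Omega>. v \<bullet> (y - x) \<le> e / c * norm (y - x)"
    using assms(1) unfolding reg_normal_cone_iff by blast
  then show "\<forall>\<^sub>F y in at x within \<Omega>. (c *\<^sub>R v) \<bullet> (y - x) \<le> e * norm (y - x)"
    by eventually_elim (use assms(2) in \<open>simp add: field_simps\<close>)
qed

text \<open>Turns normals into subgradients, so that the fuzzy chain rule for an indicator becomes a
  fuzzy preimage rule for normals.\<close>

definition set_indicator :: "'a set \<Rightarrow> 'a \<Rightarrow> ereal" where
  "set_indicator \<Omega> z = (if z \<in> \<Omega> then 0 else \<infinity>)"

lemma lsc_set_indicator: 
  assumes "closed \<Omega>"
  shows "lsc_fun (set_indicator \<Omega>)"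
  unfolding lsc_fun_def le_Liminf_iff
proof (intro allI impI)
  fix x c assume c: "c < set_indicator \<Omega> x"
  show "\<forall>\<^sub>F y in at x. c < set_indicator \<Omega> y"
  proof (cases "x \<in> \<Omega>")
    case True
    then show ?thesis using c by (auto simp: set_indicator_def intro!: always_eventually less_le_trans[of c 0])
  next
    case False
    then have "\<forall>\<^sub>F y in at x. y \<in> - \<Omega>" using assms by (simp add: eventually_at_topological open_Compl) blast
    then show ?thesis by eventually_elim (use c False in \<open>auto simp: set_indicator_def\<close>)
  qed
qed

lemma reg_subdiff_set_indicator: "reg_subdiff (set_indicator \<Omega>) x = reg_normal_cone x \<Omega>"
proof -
  have "(\<forall>\<^sub>F y in at x. set_indicator \<Omega> x + ereal (v \<bullet> (y - x)) \<le> set_indicator \<Omega> y + ereal (e * norm (y - x)))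
    \<longleftrightarrow> (\<forall>\<^sub>F y in at x within \<Omega>. v \<bullet> (y - x) \<le> e * norm (y - x))" if "x \<in> \<Omega>" for v e
    unfolding eventually_at_filter using that by (auto simp: set_indicator_def intro!: arg_cong2[where f = eventually])
  then show ?thesis
    by (cases "x \<in> \<Omega>") (auto simp: reg_subdiff_iff reg_normal_cone_iff, auto simp: set_indicator_def)
qed

text \<open>In the applications \<open>p\<close> is \<open>x\<close> or \<open>(x, w)\<close>,
  \<open>A p\<close> is the derivative in the \<open>x\<close> directions and \<open>G p\<close> the
  one in all directions of \<open>p\<close>. Hence the adjoint of \<open>A\<close> describes
  \<open>S\<close>, while the adjoint of \<open>G\<close> carries the multiplier
  \<open>q\<close>.\<close>

lemma coderiv_composite:
  fixes \<theta> :: "'m::euclidean_space \<Rightarrow> ereal" and g :: "'p::euclidean_space \<Rightarrow> 'm"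
    and A :: "'p \<Rightarrow> 'n::euclidean_space \<Rightarrow>\<^sub>L 'm" and S :: "'p \<Rightarrow> 'n set"
  assumes theta: "proper_fun \<theta>" "lsc_fun \<theta>" "convex_fun \<theta>"
    and g: "\<And>p. (g has_derivative G p) (at p)" "\<And>d. isCont (\<lambda>p. G p d) pb"
    and A: "\<And>p. (A has_derivative DA p) (at p)" "\<And>d. isCont (\<lambda>p. DA p d) pb"
    and S: "\<forall>\<^sub>F p in nhds pb. S p = {y. \<exists>v\<in>subdiff \<theta> (g p). \<forall>d. v \<bullet> A p d = y \<bullet> d}"
    and qual: "\<forall>v\<in>domain_normals \<theta> (g pb). (\<forall>d. v \<bullet> A pb d = 0) \<longrightarrow> v = 0"
    and soqc: "\<forall>v\<in>subdiff \<theta> (g pb). (\<forall>d. v \<bullet> A pb d = yb \<bullet> d) \<longrightarrow>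
        (\<forall>q\<in>second_subdiff \<theta> (g pb) v 0. (\<forall>d. q \<bullet> G pb d = 0) \<longrightarrow> q = 0)"
    and a: "a \<in> coderiv S pb yb u"
  obtains v q where "v \<in> subdiff \<theta> (g pb)" "\<And>d. v \<bullet> A pb d = yb \<bullet> d"
    "q \<in> second_subdiff \<theta> (g pb) v (A pb u)" "\<And>d. a \<bullet> d = v \<bullet> DA pb d u + q \<bullet> G pb d"
proof -
  let ?S = "\<lambda>p. S p = {y. \<exists>v\<in>subdiff \<theta> (g p). \<forall>d. v \<bullet> A p d = y \<bullet> d}"
  have contg: "isCont g p" and contA: "isCont A p" for p
    using g(1) A(1) has_derivative_continuous by metis+
  obtain ss ns where s0: "\<And>k. ss k \<in> graph S" "ss \<longlonglongrightarrow> (pb, yb)" "\<And>k. ns k \<in> reg_normal_cone (ss k) (graph S)" "ns \<longlonglongrightarrow> (a, - u)"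
    using a unfolding coderiv_def normal_cone_def mem_Collect_eq by metis
  have "\<forall>\<^sub>F p in nhds pb. \<forall>\<^sub>F p' in nhds p. ?S p'" using S by (simp add: eventually_eventually)
  then have "\<forall>\<^sub>F k in sequentially. \<forall>\<^sub>F p' in nhds (fst (ss k)). ?S p'"
    using tendsto_fst[OF s0(2)] unfolding filterlim_iff fst_conv by blast
  \<comment> \<open>The formula for \<open>S\<close> is needed on a neighborhood of each
    \<open>p k\<close>, because \<open>T\<close> has to map all of \<open>Q\<close> near
    \<open>(p k, v k)\<close> into the graph of \<open>S\<close>; \<open>N\<close> cuts off the
    indices where this may fail.\<close>
  then obtain N where N: "\<And>k. k \<ge> N \<Longrightarrow> \<forall>\<^sub>F p' in nhds (fst (ss k)). ?S p'" by (auto simp: eventually_sequentially)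
  define p where "p k = fst (ss (k + N))" for k
  define y where "y k = snd (ss (k + N))" for k
  define an where "an k = fst (ns (k + N))" for k
  define un where "un k = - snd (ns (k + N))" for k
  have lims: "p \<longlonglongrightarrow> pb" "y \<longlonglongrightarrow> yb" "an \<longlonglongrightarrow> a" "un \<longlonglongrightarrow> u"
    using tendsto_fst[OF LIMSEQ_ignore_initial_segment[OF s0(2), of N]] tendsto_snd[OF LIMSEQ_ignore_initial_segment[OF s0(2), of N]]
      tendsto_fst[OF LIMSEQ_ignore_initial_segment[OF s0(4), of N]] tendsto_minus[OF tendsto_snd[OF LIMSEQ_ignore_initial_segment[OF s0(4), of N]]]
    by (simp_all add: p_def[abs_def] y_def[abs_def] an_def[abs_def] un_def[abs_def])
  have Sp: "\<forall>\<^sub>F p' in nhds (p k). ?S p'" for k using N by (simp add: p_def)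
  have normal: "(an k, - un k) \<in> reg_normal_cone (p k, y k) (graph S)" for k
    using s0(3)[of "k + N"] by (simp add: an_def un_def p_def y_def)
  have "y k \<in> S (p k)" for k using s0(1)[of "k + N"] by (simp add: graph_def split_beta p_def y_def)
  then have "\<exists>v\<in>subdiff \<theta> (g (p k)). \<forall>d. v \<bullet> A (p k) d = y k \<bullet> d" for k
    using eventually_nhds_x_imp_x[OF Sp[of k]] by blast
  then obtain v where v: "\<And>k. v k \<in> subdiff \<theta> (g (p k))" "\<And>k d. v k \<bullet> A (p k) d = y k \<bullet> d" by metis
  have gp: "(\<lambda>k. g (p k)) \<longlonglongrightarrow> g pb" by (rule isCont_tendsto_compose[OF contg lims(1)])
  have Ap: "(\<lambda>k. A (p k)) \<longlonglongrightarrow> A pb" by (rule isCont_tendsto_compose[OF contA lims(1)])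
  \<comment> \<open>Escape of the multipliers \<open>v k\<close> would contradict
    \<open>qual\<close>, so a subsequence converges.\<close>
  have "\<exists>\<rho> vb. strict_mono \<rho> \<and> (\<lambda>k. v (\<rho> k)) \<longlonglongrightarrow> vb \<and> (\<forall>d. vb \<bullet> A pb d = yb \<bullet> d)"
  proof (rule multiplier_dichotomy[of "\<lambda>k. A (p k)" "A pb" v yb])
    show "(\<lambda>k. A (p k) d) \<longlonglongrightarrow> A pb d" for d by (intro tendsto_intros Ap)
    show "(\<lambda>k. v k \<bullet> A (p k) d) \<longlonglongrightarrow> yb \<bullet> d" for d unfolding v(2) by (intro tendsto_intros lims)
    fix \<rho> \<sigma> vb assume e: "strict_mono \<rho>" "\<And>k. \<sigma> k > (0::real)" "\<sigma> \<longlonglongrightarrow> 0"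
      "(\<lambda>k. \<sigma> k *\<^sub>R v (\<rho> k)) \<longlonglongrightarrow> vb" "vb \<noteq> 0" "\<And>d. vb \<bullet> A pb d = 0"
    have "vb \<in> domain_normals \<theta> (g pb)"
      by (rule escaping_subgradients_domain_normal[OF theta(1,2) LIMSEQ_subseq_LIMSEQ[OF gp e(1), unfolded o_def] v(1)[unfolded subdiff_convex[OF theta]] e(2,3,4)])
    then show ?thesis using qual e(5,6) by blast
  qed blast
  then obtain \<rho> vb where \<rho>: "strict_mono \<rho>" "(\<lambda>k. v (\<rho> k)) \<longlonglongrightarrow> vb" "\<And>d. vb \<bullet> A pb d = yb \<bullet> d" by blast
  note sub = LIMSEQ_subseq_LIMSEQ[OF _ \<rho>(1), unfolded o_def]
  define \<Omega> where "\<Omega> = graph (subdiff \<theta>)"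
  have cl: "closed \<Omega>" unfolding \<Omega>_def by (rule closed_graph_subdiff_convex[OF theta])
  have vb: "vb \<in> subdiff \<theta> (g pb)" unfolding subdiff_convex[OF theta]
    by (rule convex_subdiff_closed[OF theta(1,2) sub[OF gp] \<rho>(2) v(1)[unfolded subdiff_convex[OF theta]]])
  define \<Phi> :: "'p \<times> 'm \<Rightarrow> 'm \<times> 'm" where "\<Phi> s = (g (fst s), snd s)" for s
  define \<Phi>' where "\<Phi>' s d = (G (fst s) (fst d), snd d)" for s :: "'p \<times> 'm" and d :: "'p \<times> 'm"
  have \<Phi>: "(\<Phi> has_derivative \<Phi>' s) (at s)" for s
    unfolding \<Phi>_def[abs_def] \<Phi>'_def[abs_def]
    by (rule derivative_eq_intros refl has_derivative_compose[OF _ g(1)])+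
  \<comment> \<open>The sum over \<open>Basis\<close> is the adjoint of \<open>A (fst s)\<close>
    applied to \<open>snd s\<close>, written so that the product rule yields
    \<open>T'\<close>.\<close>
  define T :: "'p \<times> 'm \<Rightarrow> 'p \<times> 'n" where "T s = (fst s, \<Sum>b\<in>Basis. (snd s \<bullet> A (fst s) b) *\<^sub>R b)" for s
  define T' :: "'p \<times> 'm \<Rightarrow> 'p \<times> 'm \<Rightarrow> 'p \<times> 'n"
    where "T' s d = (fst d, \<Sum>b\<in>Basis. (snd s \<bullet> DA (fst s) (fst d) b + snd d \<bullet> A (fst s) b) *\<^sub>R b)" for s d
  have T: "(T has_derivative T' s) (at s)" for s
    unfolding T_def[abs_def] T'_def[abs_def]
    by (rule derivative_eq_intros refl has_derivative_compose[OF _ A(1)])+ (simp add: blinfun.bilinear_simps)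
  \<comment> \<open>\<open>\<xi> k\<close> is the image of the normal \<open>(an k, - un k)\<close> under the adjoint of \<open>T' (p k, v k)\<close>.\<close>
  define \<xi> where "\<xi> k = (an k - (\<Sum>b\<in>Basis. (v k \<bullet> DA (p k) b (un k)) *\<^sub>R b), - A (p k) (un k))" for k
  have linDA: "(\<Sum>b\<in>Basis. (w \<bullet> DA q b x) *\<^sub>R b) \<bullet> d = w \<bullet> DA q d x" for w q x d
  proof -
    have bl: "bounded_linear (DA q)" using A(1) by (rule has_derivative_bounded_linear)
    have "DA q d = DA q (\<Sum>b\<in>Basis. (d \<bullet> b) *\<^sub>R b)" by (simp add: euclidean_representation)
    also have "\<dots> = (\<Sum>b\<in>Basis. (d \<bullet> b) *\<^sub>R DA q b)"
      by (simp add: linear_sum[OF bounded_linear.linear[OF bl]] linear_cmul[OF bounded_linear.linear[OF bl]])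
    finally have "w \<bullet> DA q d x = w \<bullet> (\<Sum>b\<in>Basis. (d \<bullet> b) *\<^sub>R DA q b x)"
      by (simp add: blinfun.sum_left blinfun.scaleR_left)
    then show ?thesis by (simp add: inner_sum_left inner_sum_right inner_commute[of d] mult.commute)
  qed
  have reprA: "(\<Sum>b\<in>Basis. (w \<bullet> blinfun_apply L b) *\<^sub>R b) \<bullet> x = w \<bullet> L x" for w x and L :: "'n \<Rightarrow>\<^sub>L 'm"
  proof -
    have "w \<bullet> L x = w \<bullet> L (\<Sum>b\<in>Basis. (x \<bullet> b) *\<^sub>R b)" by (simp add: euclidean_representation)
    also have "\<dots> = (\<Sum>b\<in>Basis. (x \<bullet> b) * (w \<bullet> L b))"
      by (simp only: blinfun.sum_right blinfun.scaleR_right inner_sum_right inner_scaleR_right)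
    finally show ?thesis by (simp add: inner_sum_left inner_commute[of x] mult.commute)
  qed
  have T_mem: "T (p', v') \<in> graph S" if "?S p'" "v' \<in> subdiff \<theta> (g p')" for p' v'
    using that reprA unfolding graph_def T_def by auto
  have Tk: "T (p k, v k) = (p k, y k)" for k
  proof -
    have "(\<Sum>b\<in>Basis. (v k \<bullet> A (p k) b) *\<^sub>R b) = y k" unfolding v(2) by (rule euclidean_representation)
    then show ?thesis by (simp add: T_def)
  qed
  define Q where "Q = {s. \<Phi> s \<in> \<Omega>}"
  have Qk: "(p k, v k) \<in> Q" for k using v(1) by (simp add: Q_def \<Phi>_def \<Omega>_def graph_def)
  have \<xi>_normal: "\<xi> k \<in> reg_normal_cone (p k, v k) Q" for k
  proof (rule reg_normal_cone_pullback[OF T Qk])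
    show "(an k, - un k) \<in> reg_normal_cone (T (p k, v k)) (graph S)" unfolding Tk by (rule normal)
    have "filterlim fst (nhds (p k)) (at (p k, v k) within Q)"
      by (rule tendsto_eq_intros refl)+ simp
    then have "\<forall>\<^sub>F s' in at (p k, v k) within Q. ?S (fst s')"
      using Sp[of k] unfolding filterlim_iff by blast
    moreover have "\<forall>\<^sub>F s' in at (p k, v k) within Q. s' \<in> Q" by (simp add: eventually_at_filter)
    ultimately show "\<forall>\<^sub>F s' in at (p k, v k) within Q. T s' \<in> graph S"
    proof eventually_elim
      case (elim s')
      then show ?case using T_mem[of "fst s'" "snd s'"] by (simp add: Q_def \<Phi>_def \<Omega>_def graph_def)
    qed
    fix d :: "'p \<times> 'm"
    have "(\<Sum>b\<in>Basis. (v k \<bullet> DA (p k) (fst d) b + snd d \<bullet> A (p k) b) *\<^sub>R b) \<bullet> un k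
        = v k \<bullet> DA (p k) (fst d) (un k) + snd d \<bullet> A (p k) (un k)"
      by (simp add: scaleR_add_left sum.distrib inner_add_left reprA)
    then show "\<xi> k \<bullet> d = (an k, - un k) \<bullet> T' (p k, v k) d"
      by (simp add: \<xi>_def T'_def inner_prod_def inner_diff_left linDA inner_commute[of "un k"] inner_commute[of "snd d"])
  qed
  define \<xi>b where "\<xi>b = (a - (\<Sum>b\<in>Basis. (vb \<bullet> DA pb b u) *\<^sub>R b), - A pb u)"
  have \<xi>lim: "(\<lambda>k. \<xi> (\<rho> k)) \<longlonglongrightarrow> \<xi>b"
    unfolding \<xi>_def \<xi>b_def
    by (intro tendsto_intros sub[OF lims(3)] sub[OF lims(4)] \<rho>(2) sub[OF Ap] isCont_tendsto_compose[OF A(2) sub[OF lims(1)]])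
  let ?e = "\<lambda>k. inverse (real (Suc k))"
  \<comment> \<open>\<open>\<xi> (\<rho> k)\<close> is a regular subgradient of the indicator of
    \<open>Q\<close>, which is the indicator of \<open>\<Omega>\<close> composed with
    \<open>\<Phi>\<close>; the fuzzy rule transfers it to regular normals of \<open>\<Omega>\<close>
    at nearby points.\<close>
  have "\<exists>s z n. dist s (p (\<rho> k), v (\<rho> k)) < ?e k \<and> dist z (\<Phi> (p (\<rho> k), v (\<rho> k))) < ?e k
      \<and> n \<in> reg_normal_cone z \<Omega> \<and> (\<forall>d. \<bar>n \<bullet> \<Phi>' s d - \<xi> (\<rho> k) \<bullet> d\<bar> \<le> ?e k * norm d)" for k
  proof (rule fuzzy_chain_rule[OF lsc_set_indicator[OF cl] _ \<Phi>, of "\<xi> (\<rho> k)" "(p (\<rho> k), v (\<rho> k))" "?e k"])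
    show "set_indicator \<Omega> z \<noteq> -\<infinity>" for z by (simp add: set_indicator_def)
    have "(\<lambda>x. set_indicator \<Omega> (\<Phi> x)) = set_indicator Q" by (auto simp: set_indicator_def Q_def)
    then show "\<xi> (\<rho> k) \<in> reg_subdiff (\<lambda>x. set_indicator \<Omega> (\<Phi> x)) (p (\<rho> k), v (\<rho> k))"
      using \<xi>_normal by (simp add: reg_subdiff_set_indicator)
  qed (simp, unfold reg_subdiff_set_indicator, blast)
  then obtain s z n where c: "\<And>k. dist (s k) (p (\<rho> k), v (\<rho> k)) < ?e k" "\<And>k. dist (z k) (\<Phi> (p (\<rho> k), v (\<rho> k))) < ?e k"
      "\<And>k. n k \<in> reg_normal_cone (z k) \<Omega>" "\<And>k d. \<bar>n k \<bullet> \<Phi>' (s k) d - \<xi> (\<rho> k) \<bullet> d\<bar> \<le> ?e k * norm d"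
    by metis
  have slim: "s \<longlonglongrightarrow> (pb, vb)"
    by (rule tendsto_of_dist_le[OF tendsto_Pair[OF sub[OF lims(1)] \<rho>(2)] LIMSEQ_inverse_real_of_nat less_imp_le[OF c(1)]])
  have "(\<lambda>k. \<Phi> (p (\<rho> k), v (\<rho> k))) \<longlonglongrightarrow> (g pb, vb)"
    unfolding \<Phi>_def fst_conv snd_conv by (rule tendsto_Pair[OF sub[OF gp] \<rho>(2)])
  then have zlim: "z \<longlonglongrightarrow> (g pb, vb)"
    by (rule tendsto_of_dist_le[OF _ LIMSEQ_inverse_real_of_nat less_imp_le[OF c(2)]])
  have \<Phi>'lim: "(\<lambda>k. \<Phi>' (s k) d) \<longlonglongrightarrow> \<Phi>' (pb, vb) d" for d
  proof -
    have "(\<lambda>k. fst (s k)) \<longlonglongrightarrow> pb" using tendsto_fst[OF slim] by simp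
    then show ?thesis unfolding \<Phi>'_def by (intro tendsto_intros) (simp add: isCont_tendsto_compose[OF g(2)])
  qed
  have nlim: "(\<lambda>k. n k \<bullet> \<Phi>' (s k) d) \<longlonglongrightarrow> \<xi>b \<bullet> d" for d
  proof (rule tendsto_of_dist_le)
    show "(\<lambda>k. \<xi> (\<rho> k) \<bullet> d) \<longlonglongrightarrow> \<xi>b \<bullet> d" by (intro tendsto_intros \<xi>lim)
    show "(\<lambda>k. ?e k * norm d) \<longlonglongrightarrow> 0"
      by (rule tendsto_mult_left_zero[OF LIMSEQ_inverse_real_of_nat])
    show "dist (n k \<bullet> \<Phi>' (s k) d) (\<xi> (\<rho> k) \<bullet> d) \<le> ?e k * norm d" for k
      using c(4) by (simp add: dist_real_def)
  qed
  have z\<Omega>: "z k \<in> \<Omega>" for k using c(3) by (simp add: reg_normal_cone_def)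
  have zb: "(g pb, vb) \<in> \<Omega>" using vb by (simp add: \<Omega>_def graph_def)
  \<comment> \<open>Stated for arbitrary \<open>ms\<close> to serve both cases below: the normals
    \<open>n\<close> themselves and their rescaled versions.\<close>
  have limiting: "nb \<in> normal_cone (g pb, vb) \<Omega>"
    if "strict_mono \<tau>" "\<And>k. ms k \<in> reg_normal_cone (z (\<tau> k)) \<Omega>" "ms \<longlonglongrightarrow> nb" for \<tau> ms nb
    unfolding normal_cone_def mem_Collect_eq
    using that zb z\<Omega> LIMSEQ_subseq_LIMSEQ[OF zlim that(1), unfolded o_def]
    by (intro conjI exI[of _ "\<lambda>k. z (\<tau> k)"] exI[of _ ms]) auto
  from \<Phi>'lim nlim show ?thesis
  proof (cases rule: multiplier_dichotomy)
    case (convergent \<tau> nb)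
    have nb: "nb \<in> normal_cone (g pb, vb) \<Omega>" by (rule limiting[OF convergent(1) c(3) convergent(2)])
    \<comment> \<open>Setting \<open>d = 0\<close> identifies the second component as
      \<open>- A pb u\<close>; setting \<open>w = 0\<close> yields the formula for
      \<open>a\<close>.\<close>
    have eq: "fst nb \<bullet> G pb d + snd nb \<bullet> w = (a \<bullet> d - vb \<bullet> DA pb d u) - A pb u \<bullet> w" for d w
      using convergent(3)[of "(d, w)"] by (simp add: \<Phi>'_def \<xi>b_def inner_prod_def inner_diff_left linDA)
    have DA0: "DA pb 0 = 0" "G pb 0 = 0" using A(1)[of pb] g(1)[of pb] by (simp_all add: has_derivative_bounded_linear linear_simps)
    have "snd nb \<bullet> w = - A pb u \<bullet> w" for w using eq[of 0 w] by (simp add: DA0)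
    then have "snd nb = - A pb u" by (metis vector_eq_rdot)
    then have "fst nb \<in> second_subdiff \<theta> (g pb) vb (A pb u)"
      using nb by (simp add: second_subdiff_def coderiv_def \<Omega>_def) (metis prod.collapse)
    moreover have "a \<bullet> d = vb \<bullet> DA pb d u + fst nb \<bullet> G pb d" for d using eq[of d 0] by simp
    ultimately show ?thesis using that vb \<rho>(3) by blast
  next
    case (escaping \<tau> \<sigma> nb)
    have nb: "nb \<in> normal_cone (g pb, vb) \<Omega>"
      by (rule limiting[OF escaping(1) reg_normal_cone_scaleR[OF c(3) escaping(2)] escaping(4)])
    \<comment> \<open>The limit annihilates the range of \<open>\<Phi>' (pb, vb)\<close>. Hence its
      second component vanishes, and its first lies in the second-order subdifferential at 0, where
      \<open>soqc\<close> makes it zero.\<close>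
    have eq: "fst nb \<bullet> G pb d + snd nb \<bullet> w = 0" for d w
      using escaping(6)[of "(d, w)"] by (simp add: \<Phi>'_def inner_prod_def)
    have G0: "G pb 0 = 0" using g(1)[of pb] by (simp add: has_derivative_bounded_linear linear_simps)
    have snd0: "snd nb = 0" using eq[of 0 "snd nb"] by (simp add: G0)
    then have "fst nb \<in> second_subdiff \<theta> (g pb) vb 0"
      using nb by (simp add: second_subdiff_def coderiv_def \<Omega>_def) (metis prod.collapse)
    then have "fst nb = 0" using soqc vb \<rho>(3) eq[of _ 0] by simp
    then show ?thesis using snd0 escaping(5) by (simp add: prod_eq_iff)
  qed
qed

subsection \<open>The second-order chain rule\<close>

lemma adjoint_eq_iff:
  fixes f :: "'a::euclidean_space \<Rightarrow> 'b::euclidean_space"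
  assumes "linear f"
  shows "adjoint f v = y \<longleftrightarrow> (\<forall>d. v \<bullet> f d = y \<bullet> d)"
proof -
  have "v \<bullet> f d = adjoint f v \<bullet> d" for d
    using adjoint_works[OF assms, of d v] by (simp add: inner_commute)
  then show ?thesis by (metis vector_eq_rdot)
qed

lemma linear_jac_x: "linear (jac_x L)" and linear_jac_w: "linear (jac_w L)"
  by (auto simp: jac_x_def jac_w_def blinfun.add_right[symmetric] blinfun.scaleR_right[symmetric] intro!: linearI)

lemma vec_axis_inner:
  fixes f :: "real^'n \<Rightarrow> real"
  assumes "linear f"
  shows "(\<chi> i. f (axis i 1)) \<bullet> d = f d"
proof -
  have "f d = f (\<Sum>i\<in>UNIV. d $ i *\<^sub>R axis i 1)"
    using basis_expansion[of d] by (simp add: scalar_mult_eq_scaleR)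
  also have "\<dots> = (\<Sum>i\<in>UNIV. d $ i * f (axis i 1))"
    by (simp add: linear_sum[OF assms] linear_cmul[OF assms])
  finally show ?thesis by (simp add: inner_vec_def mult.commute)
qed

lemma hess_xx_inner: "hess_xx B v u \<bullet> d = v \<bullet> B (d, 0) (u, 0)"
proof -
  have "linear (\<lambda>d. v \<bullet> B (d, 0) (u, 0))"
  proof (rule linearI)
    show "v \<bullet> B (d + e, 0) (u, 0) = v \<bullet> B (d, 0) (u, 0) + v \<bullet> B (e, 0) (u, 0)" for d e
      using blinfun.add_right[of B "(d, 0)" "(e, 0)"] by (simp add: blinfun.add_left inner_add_right)
    show "v \<bullet> B (r *\<^sub>R d, 0) (u, 0) = r *\<^sub>R (v \<bullet> B (d, 0) (u, 0))" for r d
      using blinfun.scaleR_right[of B r "(d, 0)"] by (simp add: blinfun.scaleR_left)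
  qed
  then show ?thesis unfolding hess_xx_def by (rule vec_axis_inner)
qed

lemma hess_xw_inner: "hess_xw B v u \<bullet> d = v \<bullet> B (0, d) (u, 0)"
proof -
  have "linear (\<lambda>d. v \<bullet> B (0, d) (u, 0))"
  proof (rule linearI)
    show "v \<bullet> B (0, d + e) (u, 0) = v \<bullet> B (0, d) (u, 0) + v \<bullet> B (0, e) (u, 0)" for d e
      using blinfun.add_right[of B "(0, d)" "(0, e)"] by (simp add: blinfun.add_left inner_add_right)
    show "v \<bullet> B (0, r *\<^sub>R d) (u, 0) = r *\<^sub>R (v \<bullet> B (0, d) (u, 0))" for r d
      using blinfun.scaleR_right[of B r "(0, d)"] by (simp add: blinfun.scaleR_left)
  qed
  then show ?thesis unfolding hess_xw_def by (rule vec_axis_inner)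
qed

text \<open>Composition with this injection restricts a derivative to the \<open>x\<close>
  directions as a bounded linear map, so that the calculus of \<open>blinfun\<close> composition
  applies to the partial Jacobian.\<close>

lift_definition inl_blinfun :: "'a::real_normed_vector \<Rightarrow>\<^sub>L ('a \<times> 'b::real_normed_vector)" is "\<lambda>x. (x, 0)"
  by (intro bounded_linear_Pair bounded_linear_ident bounded_linear_zero)

lemma inl_blinfun_apply [simp]: "inl_blinfun x = (x, 0)"
  by transfer simp

text \<open>With \<open>w\<close> frozen, both inclusions of the first-order chain rule apply. The
  representation on \<open>V\<close> suffices because its slice at \<open>w\<close> is open and
  subdifferentials are local.\<close>

lemma partial_chain_rule:
  fixes \<phi> :: "'n::euclidean_space \<times> 'd::euclidean_space \<Rightarrow> ereal" and h :: "'n \<times> 'd \<Rightarrow> 'm::euclidean_space"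
  assumes theta: "proper_fun \<theta>" "lsc_fun \<theta>" "convex_fun \<theta>"
    and h: "C2_with h Dh D2h" and V: "open V" "p \<in> V" "\<And>p. p \<in> V \<Longrightarrow> \<phi> p = \<theta> (h p)"
    and qual: "\<forall>v\<in>domain_normals \<theta> (h p). (\<forall>d. v \<bullet> Dh p (d, 0) = 0) \<longrightarrow> v = 0"
  shows "partial_subdiff_x \<phi> p = {y. \<exists>v\<in>subdiff \<theta> (h p). \<forall>d. v \<bullet> Dh p (d, 0) = y \<bullet> d}"
proof -
  obtain x w where p: "p = (x, w)" by (cases p)
  let ?F = "\<lambda>x. h (x, w)" and ?F' = "\<lambda>x. Dh (x, w) o\<^sub>L inl_blinfun"
  have D: "(?F has_derivative blinfun_apply (?F' x)) (at x)" for x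
  proof -
    have "((\<lambda>x. (x, w)) has_derivative (\<lambda>d. (d, 0))) (at x)"
      by (rule derivative_eq_intros refl)+
    moreover have "(h has_derivative blinfun_apply (Dh (x, w))) (at (x, w))" using h by (simp add: C2_with_def)
    ultimately have "(?F has_derivative (\<lambda>d. Dh (x, w) (d, 0))) (at x)"
      by (rule has_derivative_compose)
    moreover have "blinfun_apply (?F' x) = (\<lambda>d. Dh (x, w) (d, 0))" by (simp add: fun_eq_iff)
    ultimately show ?thesis by simp
  qed
  have contD: "isCont Dh q" for q using h has_derivative_continuous by (metis C2_with_def)
  have cont: "isCont ?F' x"
    by (intro continuous_intros isCont_o2[OF _ contD])
  have "partial_subdiff_x \<phi> p = subdiff (\<lambda>x. \<theta> (?F x)) x"
    unfolding partial_subdiff_x_def p fst_conv snd_conv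
  proof (rule subdiff_cong_open)
    show "open ((\<lambda>x. (x, w)) -` V)" by (intro open_vimage V continuous_intros)
    show "x \<in> (\<lambda>x. (x, w)) -` V" using V(2) p by simp
  qed (use V(3) in auto)
  also have "\<dots> = {y. \<exists>v\<in>subdiff \<theta> (h p). \<forall>d. v \<bullet> Dh p (d, 0) = y \<bullet> d}"
  proof (intro equalityI subsetI)
    fix y assume "y \<in> subdiff (\<lambda>x. \<theta> (?F x)) x"
    then have "\<exists>v\<in>convex_subdiff \<theta> (?F x). \<forall>d. v \<bullet> ?F' x d = y \<bullet> d"
      by (rule chain_rule_subset[OF theta D cont, rotated]) (use qual p in auto)
    then show "y \<in> {y. \<exists>v\<in>subdiff \<theta> (h p). \<forall>d. v \<bullet> Dh p (d, 0) = y \<bullet> d}"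
      by (simp add: p subdiff_convex[OF theta])
  next
    fix y assume "y \<in> {y. \<exists>v\<in>subdiff \<theta> (h p). \<forall>d. v \<bullet> Dh p (d, 0) = y \<bullet> d}"
    then obtain v where "v \<in> convex_subdiff \<theta> (?F x)" "\<And>d. v \<bullet> ?F' x d = y \<bullet> d"
      by (auto simp: p subdiff_convex[OF theta])
    then show "y \<in> subdiff (\<lambda>x. \<theta> (?F x)) x" using chain_rule_superset[OF _ D] by blast
  qed
  finally show ?thesis .
qed

theorem theorem3p3:
  fixes \<phi> :: "((real^'n) \<times> (real^'d)) \<Rightarrow> ereal"
    and \<theta> :: "real^'m \<Rightarrow> ereal"
    and h :: "((real^'n) \<times> (real^'d)) \<Rightarrow> real^'m"
    and Dh :: "((real^'n) \<times> (real^'d)) \<Rightarrow> (((real^'n) \<times> (real^'d)) \<Rightarrow>\<^sub>L (real^'m))"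
    and D2h :: "((real^'n) \<times> (real^'d)) \<Rightarrow> (((real^'n) \<times> (real^'d)) \<Rightarrow>\<^sub>L (((real^'n) \<times> (real^'d)) \<Rightarrow>\<^sub>L (real^'m)))"
    and V :: "((real^'n) \<times> (real^'d)) set"
    and xb :: "real^'n" and wb :: "real^'d" and yb :: "real^'n"
  assumes phi_proper: "\<forall>p. \<phi> p \<noteq> -\<infinity>"
    and V_nhd: "open V" "(xb, wb) \<in> V"
    and rep: "\<forall>p\<in>V. \<phi> p = \<theta> (h p)"
    and h_C2: "C2_with h Dh D2h"
    and theta: "proper_fun \<theta>" "lsc_fun \<theta>" "convex_fun \<theta>"
    and qual: "sing_subdiff \<theta> (h (xb, wb)) \<inter> {v. adjoint (jac_x (Dh (xb, wb))) v = 0} = {0}"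
    and yb: "yb \<in> partial_subdiff_x \<phi> (xb, wb)"
    and SOQC: "\<forall>v\<in>{v. v \<in> subdiff \<theta> (h (xb, wb)) \<and> adjoint (jac_x (Dh (xb, wb))) v = yb}.
                 second_subdiff \<theta> (h (xb, wb)) v 0 \<inter> {q. adjoint (jac_x (Dh (xb, wb))) q = 0} = {0}"
  shows "\<forall>u. second_subdiff_x \<phi> xb wb yb u \<subseteq>
            (\<Union>v\<in>{v. v \<in> subdiff \<theta> (h (xb, wb)) \<and> adjoint (jac_x (Dh (xb, wb))) v = yb}.
               (\<lambda>q. hess_xx (D2h (xb, wb)) v u + adjoint (jac_x (Dh (xb, wb))) q)
                 ` second_subdiff \<theta> (h (xb, wb)) v (jac_x (Dh (xb, wb)) u))
       \<and> (\<forall>u. second_subdiff_x_tilde \<phi> xb wb yb u \<subseteq>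
            (\<Union>v\<in>{v. v \<in> subdiff \<theta> (h (xb, wb)) \<and> adjoint (jac_x (Dh (xb, wb))) v = yb}.
               (\<lambda>q. (hess_xx (D2h (xb, wb)) v u + adjoint (jac_x (Dh (xb, wb))) q,
                      hess_xw (D2h (xb, wb)) v u + adjoint (jac_w (Dh (xb, wb))) q))
                 ` second_subdiff \<theta> (h (xb, wb)) v (jac_x (Dh (xb, wb)) u)))"
proof -
  let ?pb = "(xb, wb)"
  let ?zb = "h ?pb"
  have hder: "\<And>p. (h has_derivative blinfun_apply (Dh p)) (at p)"
    and Dhder: "\<And>p. (Dh has_derivative blinfun_apply (D2h p)) (at p)"
    and contD2: "\<And>p. isCont D2h p"
    using h_C2 by (auto simp: C2_with_def continuous_on_eq_continuous_at)
  have conth: "\<And>p. isCont h p" and contD: "\<And>p. isCont Dh p"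
    using hder Dhder has_derivative_continuous by metis+
  have adj: "adjoint (jac_x L) v = y \<longleftrightarrow> (\<forall>d. v \<bullet> L (d, 0) = y \<bullet> d)"
    for L :: "((real^'n) \<times> (real^'d)) \<Rightarrow>\<^sub>L (real^'m)" and v y
    using adjoint_eq_iff[OF linear_jac_x] by (simp add: jac_x_def)
  have adjw: "adjoint (jac_w L) v = y \<longleftrightarrow> (\<forall>d. v \<bullet> L (0, d) = y \<bullet> d)"
    for L :: "((real^'n) \<times> (real^'d)) \<Rightarrow>\<^sub>L (real^'m)" and v y
    using adjoint_eq_iff[OF linear_jac_w] by (simp add: jac_w_def)
  define A where "A p = Dh p o\<^sub>L inl_blinfun" for p
  define DA where "DA p d = D2h p d o\<^sub>L inl_blinfun" for p d
  have A_apply: "A p d = Dh p (d, 0)" and DA_apply: "DA p e d = D2h p e (d, 0)" for p d e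
    by (simp_all add: A_def DA_def)
  have Ader: "(A has_derivative DA p) (at p)" for p
    unfolding A_def[abs_def] DA_def[abs_def]
    by (rule bounded_linear.has_derivative[OF bounded_bilinear.bounded_linear_left[OF bounded_bilinear_blinfun_compose] Dhder])
  have contA: "isCont A p" for p using Ader has_derivative_continuous by metis
  have contDA: "isCont (\<lambda>p. DA p d) p" for p d
    unfolding DA_def by (intro continuous_intros contD2)
  have fin: "\<bar>\<theta> ?zb\<bar> \<noteq> \<infinity>"
    using yb rep V_nhd by (simp add: partial_subdiff_x_def subdiff_def)
  \<comment> \<open>Where \<open>\<theta>\<close> is finite, domain normals are singular
    subgradients, so the given qualification condition implies the one for
    \<open>domain_normals\<close>.\<close>
  have q0: "\<forall>v\<in>domain_normals \<theta> ?zb. (\<forall>d. v \<bullet> A ?pb d = 0) \<longrightarrow> v = 0"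
  proof (intro ballI impI)
    fix v assume v: "v \<in> domain_normals \<theta> ?zb" "\<forall>d. v \<bullet> A ?pb d = 0"
    have "v \<in> sing_subdiff \<theta> ?zb" using domain_normals_subset_sing_subdiff[OF theta fin] v(1) by blast
    moreover have "adjoint (jac_x (Dh ?pb)) v = 0" using v(2) by (simp add: adj A_apply)
    ultimately show "v = 0" using qual by blast
  qed
  have soqc: "\<forall>v\<in>subdiff \<theta> ?zb. (\<forall>d. v \<bullet> A ?pb d = yb \<bullet> d) \<longrightarrow>
      (\<forall>q\<in>second_subdiff \<theta> ?zb v 0. (\<forall>d. q \<bullet> Dh ?pb (d, 0) = 0) \<longrightarrow> q = 0)"
    using SOQC by (auto simp: adj A_apply set_eq_iff)
  have "\<forall>\<^sub>F p in nhds ?pb. p \<in> V" using V_nhd by (rule eventually_nhds_in_open)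
  moreover have "\<forall>\<^sub>F p in nhds ?pb. \<forall>v\<in>domain_normals \<theta> (h p). (\<forall>d. v \<bullet> A p d = 0) \<longrightarrow> v = 0"
    by (rule domain_qualification_robust[OF conth contA q0])
  \<comment> \<open>The qualification condition persists nearby, so the chain rule describes the
    graph of the partial subdifferential around the base point.\<close>
  ultimately have S: "\<forall>\<^sub>F p in nhds ?pb. partial_subdiff_x \<phi> p = {y. \<exists>v\<in>subdiff \<theta> (h p). \<forall>d. v \<bullet> A p d = y \<bullet> d}"
  proof eventually_elim
    case (elim p)
    show ?case unfolding A_apply
      by (rule partial_chain_rule[OF theta h_C2 V_nhd(1) elim(1)]) (use rep elim(2) A_apply in auto)
  qed
  have "a \<in> (\<Union>v\<in>{v. v \<in> subdiff \<theta> ?zb \<and> adjoint (jac_x (Dh ?pb)) v = yb}.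
      (\<lambda>q. hess_xx (D2h ?pb) v u + adjoint (jac_x (Dh ?pb)) q) ` second_subdiff \<theta> ?zb v (jac_x (Dh ?pb) u))"
    if a: "a \<in> second_subdiff_x \<phi> xb wb yb u" for a u
  proof -
    \<comment> \<open>Freezing \<open>w = wb\<close> makes \<open>x\<close> the parameter;
      derivatives of the inner map and of its partial Jacobian are then taken only in directions
      \<open>(d, 0)\<close>.\<close>
    have incl: "((\<lambda>x. (x, wb)) has_derivative (\<lambda>d. (d, 0))) (at x)" for x
      by (rule derivative_eq_intros refl)+
    have conti: "isCont (\<lambda>x. (x, wb)) x" for x by (intro continuous_intros)
    have a': "a \<in> coderiv (\<lambda>x. partial_subdiff_x \<phi> (x, wb)) xb yb u"
      using a by (simp add: second_subdiff_x_def second_subdiff_def partial_subdiff_x_def[abs_def])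
    have hd: "((\<lambda>x. h (x, wb)) has_derivative (\<lambda>d. Dh (x, wb) (d, 0))) (at x)" for x
      by (rule has_derivative_compose[OF incl hder])
    have Ad: "((\<lambda>x. A (x, wb)) has_derivative (\<lambda>d. DA (x, wb) (d, 0))) (at x)" for x
      by (rule has_derivative_compose[OF incl Ader])
    have hc: "isCont (\<lambda>x. Dh (x, wb) (d, 0)) xb" for d
      by (intro continuous_intros isCont_o2[OF conti contD])
    have Ac: "isCont (\<lambda>x. DA (x, wb) (d, 0)) xb" for d
      by (rule isCont_o2[OF conti contDA])
    have "filterlim (\<lambda>x. (x, wb)) (nhds ?pb) (nhds xb)" by (intro tendsto_intros filterlim_ident)
    then have Sx: "\<forall>\<^sub>F x in nhds xb. partial_subdiff_x \<phi> (x, wb) = {y. \<exists>v\<in>subdiff \<theta> (h (x, wb)). \<forall>d. v \<bullet> A (x, wb) d = y \<bullet> d}"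
      using S unfolding filterlim_iff by blast
    obtain v q where vq: "v \<in> subdiff \<theta> ?zb" "\<And>d. v \<bullet> A ?pb d = yb \<bullet> d"
      "q \<in> second_subdiff \<theta> ?zb v (A ?pb u)" "\<And>d. a \<bullet> d = v \<bullet> DA ?pb (d, 0) u + q \<bullet> Dh ?pb (d, 0)"
      using coderiv_composite[where g = "\<lambda>x. h (x, wb)" and A = "\<lambda>x. A (x, wb)" and pb = xb,
          OF theta hd hc Ad Ac Sx q0 soqc a'] by metis
    have "a = hess_xx (D2h ?pb) v u + adjoint (jac_x (Dh ?pb)) q"
    proof -
      have "adjoint (jac_x (Dh ?pb)) q \<bullet> d = q \<bullet> Dh ?pb (d, 0)" for d using adj[of "Dh ?pb" q] by metis
      then have "a \<bullet> d = (hess_xx (D2h ?pb) v u + adjoint (jac_x (Dh ?pb)) q) \<bullet> d" for d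
        by (simp add: vq(4) inner_add_left hess_xx_inner DA_apply)
      then show ?thesis by (metis vector_eq_rdot)
    qed
    then show ?thesis using vq(1-3) by (auto simp: adj A_apply jac_x_def)
  qed
  moreover have "a \<in> (\<Union>v\<in>{v. v \<in> subdiff \<theta> ?zb \<and> adjoint (jac_x (Dh ?pb)) v = yb}.
      (\<lambda>q. (hess_xx (D2h ?pb) v u + adjoint (jac_x (Dh ?pb)) q, hess_xw (D2h ?pb) v u + adjoint (jac_w (Dh ?pb)) q))
        ` second_subdiff \<theta> ?zb v (jac_x (Dh ?pb) u))"
    if a: "a \<in> second_subdiff_x_tilde \<phi> xb wb yb u" for a u
  proof -
    have contDd: "isCont (\<lambda>p. Dh p d) p" for p d by (intro continuous_intros contD)
    \<comment> \<open>Annihilating the range of the full derivative is stronger than annihilating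
      that of its \<open>x\<close> part, so the same condition suffices.\<close>
    have soqc': "\<forall>v\<in>subdiff \<theta> ?zb. (\<forall>d. v \<bullet> A ?pb d = yb \<bullet> d) \<longrightarrow>
      (\<forall>q\<in>second_subdiff \<theta> ?zb v 0. (\<forall>d. q \<bullet> Dh ?pb d = 0) \<longrightarrow> q = 0)"
      using soqc by blast
    obtain v q where vq: "v \<in> subdiff \<theta> ?zb" "\<And>d. v \<bullet> A ?pb d = yb \<bullet> d"
      "q \<in> second_subdiff \<theta> ?zb v (A ?pb u)" "\<And>d. a \<bullet> d = v \<bullet> DA ?pb d u + q \<bullet> Dh ?pb d"
      using coderiv_composite[OF theta hder contDd Ader contDA S q0 soqc' a[unfolded second_subdiff_x_tilde_def]] by metis
    \<comment> \<open>Testing with \<open>(d, 0)\<close> and with \<open>(0, d)\<close> separates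
      the two components.\<close>
    have "fst a = hess_xx (D2h ?pb) v u + adjoint (jac_x (Dh ?pb)) q"
    proof -
      have "adjoint (jac_x (Dh ?pb)) q \<bullet> d = q \<bullet> Dh ?pb (d, 0)" for d using adj[of "Dh ?pb" q] by metis
      moreover have "fst a \<bullet> d = a \<bullet> (d, 0)" for d by (simp add: inner_prod_def)
      ultimately have "fst a \<bullet> d = (hess_xx (D2h ?pb) v u + adjoint (jac_x (Dh ?pb)) q) \<bullet> d" for d
        by (simp add: vq(4) inner_add_left hess_xx_inner DA_apply)
      then show ?thesis by (metis vector_eq_rdot)
    qed
    moreover have "snd a = hess_xw (D2h ?pb) v u + adjoint (jac_w (Dh ?pb)) q"
    proof -
      have "adjoint (jac_w (Dh ?pb)) q \<bullet> d = q \<bullet> Dh ?pb (0, d)" for d using adjw[of "Dh ?pb" q] by metis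
      moreover have "snd a \<bullet> d = a \<bullet> (0, d)" for d by (simp add: inner_prod_def)
      ultimately have "snd a \<bullet> d = (hess_xw (D2h ?pb) v u + adjoint (jac_w (Dh ?pb)) q) \<bullet> d" for d
        by (simp add: vq(4) inner_add_left hess_xw_inner DA_apply)
      then show ?thesis by (metis vector_eq_rdot)
    qed
    ultimately have "a = (hess_xx (D2h ?pb) v u + adjoint (jac_x (Dh ?pb)) q, hess_xw (D2h ?pb) v u + adjoint (jac_w (Dh ?pb)) q)"
      by (simp add: prod_eq_iff)
    then show ?thesis using vq(1-3) by (auto simp: adj A_apply jac_x_def)
  qed
  ultimately show ?thesis by blast
qed

end
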